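(* Suppose an amenable group $G$ acts on a dendrite $X$. Then: (1) Each minimal subset $M\subset X$ is almost automorphic: there are a minimal equicontinuous system $(G,Z)$ and a factor map $\iota:M\to Z$ which is an almost one-to-one extension. Moreover, $M$ carries a unique $G$-invariant probability measure $\mu$, and $\iota$ is a measure-theoretic isomorphism $\iota:(M,\mu,G)\to(Z,\lambda,G)$, where $\lambda$ is the Haar measure on the homogeneous space $Z$. (2) Thus an ergodic $G$-invariant probability measure on $X$ is either a uniform distribution on a finite set, or it is the unique invariant probability measure on a minimal infinite almost automorphic subset $M\subset X$.
   Context: A dendron is a compact connected Hausdorff space in which every pair of distinct points is separated by a third point (i.e. for distinct $u,v$ there is $w$ such that the complement of $w$ is a union of two disjoint open sets containing $u$ and $v$ respectively); a dendrite is a metrizable dendron. Actions are by homeomorphisms (continuous, if $G$ is a topological group); amenability is used in the sense that every compact $G$-system admits an invariant probability measure. A minimal subset is a nonempty closed $G$-invariant subset with no proper such subset. A factor map is a continuous surjective $G$-equivariant map. A factor map $\iota:M\to Z$ of minimal metrizable systems is an almost one-to-one extension if the set $\{x\in M:\iota^{-1}(\iota(x))=\{x\}\}$ is a dense $G_\delta$ subset of $M$. A system is almost automorphic if it is minimal and is an almost one-to-one extension of an equicontinuous system. A minimal equicontinuous system $Z$ is a homogeneous space of the compact group $K$, the closure of the image of $G$ in the homeomorphism group of $Z$; its Haar measure $\lambda$ is the unique $K$-invariant probability measure. *)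

theory Defs
  imports
    "HOL-Probability.Probability"
    "HOL-Algebra.Group_Action"
begin

section \<open>Dendrites\<close>

definition dendron :: "'x topology \<Rightarrow> bool" where
  "dendron X \<longleftrightarrow>
     compact_space X \<and> connected_space X \<and> Hausdorff_space X \<and>
     (\<forall>u\<in>topspace X. \<forall>v\<in>topspace X. u \<noteq> v \<longrightarrow>
        (\<exists>w\<in>topspace X. \<exists>U V. openin X U \<and> openin X V \<and> U \<inter> V = {} \<and>
           U \<union> V = topspace X - {w} \<and> u \<in> U \<and> v \<in> V))"

definition dendrite :: "'x topology \<Rightarrow> bool" where
  "dendrite X \<longleftrightarrow> dendron X \<and> metrizable_space X"


section \<open>Topological groups and compact systems\<close>

text \<open>An abstract group is covered by taking the discrete topology on its carrier.\<close>

definition topological_group :: "('g, 'm) monoid_scheme \<Rightarrow> 'g topology \<Rightarrow> bool" where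
  "topological_group G TG \<longleftrightarrow>
     group G \<and> topspace TG = carrier G \<and>
     continuous_map (prod_topology TG TG) TG (\<lambda>(g, h). g \<otimes>\<^bsub>G\<^esub> h) \<and>
     continuous_map TG TG (\<lambda>g. inv\<^bsub>G\<^esub> g)"

definition compact_system ::
  "('g, 'm) monoid_scheme \<Rightarrow> 'g topology \<Rightarrow> 'x topology \<Rightarrow> ('g \<Rightarrow> 'x \<Rightarrow> 'x) \<Rightarrow> bool" where
  "compact_system G TG X \<phi> \<longleftrightarrow>
     compact_space X \<and> Hausdorff_space X \<and>
     group_action G (topspace X) \<phi> \<and>
     continuous_map (prod_topology TG X) X (\<lambda>(g, x). \<phi> g x)"

text \<open>The maps of a \<^const>\<open>group_action\<close> are extensional, so they have to be cut down
  when passing to a subsystem.\<close>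

definition restrict_action :: "('g \<Rightarrow> 'x \<Rightarrow> 'x) \<Rightarrow> 'x set \<Rightarrow> 'g \<Rightarrow> 'x \<Rightarrow> 'x" where
  "restrict_action \<phi> M = (\<lambda>g. restrict (\<phi> g) M)"

definition invariant_set ::
  "('g, 'm) monoid_scheme \<Rightarrow> ('g \<Rightarrow> 'x \<Rightarrow> 'x) \<Rightarrow> 'x set \<Rightarrow> bool" where
  "invariant_set G \<phi> A \<longleftrightarrow> (\<forall>g\<in>carrier G. \<phi> g ` A \<subseteq> A)"

definition minimal_subset ::
  "('g, 'm) monoid_scheme \<Rightarrow> 'x topology \<Rightarrow> ('g \<Rightarrow> 'x \<Rightarrow> 'x) \<Rightarrow> 'x set \<Rightarrow> bool" where
  "minimal_subset G X \<phi> M \<longleftrightarrow>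
     M \<noteq> {} \<and> closedin X M \<and> invariant_set G \<phi> M \<and>
     (\<forall>N. N \<noteq> {} \<and> closedin X N \<and> invariant_set G \<phi> N \<and> N \<subseteq> M \<longrightarrow> N = M)"

definition minimal_system ::
  "('g, 'm) monoid_scheme \<Rightarrow> 'g topology \<Rightarrow> 'x topology \<Rightarrow> ('g \<Rightarrow> 'x \<Rightarrow> 'x) \<Rightarrow> bool" where
  "minimal_system G TG X \<phi> \<longleftrightarrow>
     compact_system G TG X \<phi> \<and> minimal_subset G X \<phi> (topspace X)"

text \<open>By compactness the choice of the compatible metric is immaterial.\<close>

definition equicontinuous_system ::
  "('g, 'm) monoid_scheme \<Rightarrow> 'g topology \<Rightarrow> 'x topology \<Rightarrow> ('g \<Rightarrow> 'x \<Rightarrow> 'x) \<Rightarrow> bool" where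
  "equicontinuous_system G TG X \<phi> \<longleftrightarrow>
     compact_system G TG X \<phi> \<and>
     (\<exists>d. Metric_space (topspace X) d \<and> Metric_space.mtopology (topspace X) d = X \<and>
        (\<forall>\<epsilon>>0. \<exists>\<delta>>0. \<forall>g\<in>carrier G. \<forall>x\<in>topspace X. \<forall>y\<in>topspace X.
           d x y < \<delta> \<longrightarrow> d (\<phi> g x) (\<phi> g y) < \<epsilon>))"

definition factor_map ::
  "('g, 'm) monoid_scheme \<Rightarrow> 'x topology \<Rightarrow> ('g \<Rightarrow> 'x \<Rightarrow> 'x) \<Rightarrow>
   'z topology \<Rightarrow> ('g \<Rightarrow> 'z \<Rightarrow> 'z) \<Rightarrow> ('x \<Rightarrow> 'z) \<Rightarrow> bool" where
  "factor_map G X \<phi> Z \<psi> \<iota> \<longleftrightarrow>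
     continuous_map X Z \<iota> \<and> \<iota> ` topspace X = topspace Z \<and>
     (\<forall>g\<in>carrier G. \<forall>x\<in>topspace X. \<iota> (\<phi> g x) = \<psi> g (\<iota> x))"

definition singleton_fibre_points :: "'x topology \<Rightarrow> ('x \<Rightarrow> 'z) \<Rightarrow> 'x set" where
  "singleton_fibre_points X \<iota> =
     {x \<in> topspace X. {y \<in> topspace X. \<iota> y = \<iota> x} = {x}}"

definition almost_one_to_one_extension ::
  "('g, 'm) monoid_scheme \<Rightarrow> 'g topology \<Rightarrow> 'x topology \<Rightarrow> ('g \<Rightarrow> 'x \<Rightarrow> 'x) \<Rightarrow>
   'z topology \<Rightarrow> ('g \<Rightarrow> 'z \<Rightarrow> 'z) \<Rightarrow> ('x \<Rightarrow> 'z) \<Rightarrow> bool" where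
  "almost_one_to_one_extension G TG X \<phi> Z \<psi> \<iota> \<longleftrightarrow>
     minimal_system G TG X \<phi> \<and> metrizable_space X \<and>
     minimal_system G TG Z \<psi> \<and> metrizable_space Z \<and>
     factor_map G X \<phi> Z \<psi> \<iota> \<and>
     gdelta_in X (singleton_fibre_points X \<iota>) \<and>
     X closure_of (singleton_fibre_points X \<iota>) = topspace X"

text \<open>Up to isomorphism, every factor of a system on \<^typ>\<open>'x\<close> lives on the set of fibres
  of its factor map. Hence it is no restriction to look for \<open>Z\<close> in the type \<^typ>\<open>'x set\<close>.\<close>

definition almost_automorphic ::
  "('g, 'm) monoid_scheme \<Rightarrow> 'g topology \<Rightarrow> 'x topology \<Rightarrow> ('g \<Rightarrow> 'x \<Rightarrow> 'x) \<Rightarrow> bool" where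
  "almost_automorphic G TG X \<phi> \<longleftrightarrow>
     (\<exists>(Z :: 'x set topology) \<psi> \<iota>.
        equicontinuous_system G TG Z \<psi> \<and> almost_one_to_one_extension G TG X \<phi> Z \<psi> \<iota>)"


section \<open>Invariant measures and amenability\<close>

definition borel_of :: "'x topology \<Rightarrow> 'x measure" where
  "borel_of X = sigma (topspace X) {U. openin X U}"

definition borel_prob :: "'x topology \<Rightarrow> 'x measure \<Rightarrow> bool" where
  "borel_prob X \<mu> \<longleftrightarrow> prob_space \<mu> \<and> sets \<mu> = sets (borel_of X)"

definition invariant_prob ::
  "('g, 'm) monoid_scheme \<Rightarrow> 'x topology \<Rightarrow> ('g \<Rightarrow> 'x \<Rightarrow> 'x) \<Rightarrow> 'x measure \<Rightarrow> bool" where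
  "invariant_prob G X \<phi> \<mu> \<longleftrightarrow>
     borel_prob X \<mu> \<and> (\<forall>g\<in>carrier G. distr \<mu> (borel_of X) (\<phi> g) = \<mu>)"

definition unique_invariant_prob ::
  "('g, 'm) monoid_scheme \<Rightarrow> 'x topology \<Rightarrow> ('g \<Rightarrow> 'x \<Rightarrow> 'x) \<Rightarrow> 'x measure \<Rightarrow> bool" where
  "unique_invariant_prob G X \<phi> \<mu> \<longleftrightarrow>
     invariant_prob G X \<phi> \<mu> \<and> (\<forall>\<nu>. invariant_prob G X \<phi> \<nu> \<longrightarrow> \<nu> = \<mu>)"

text \<open>Ergodicity refers to sets that are invariant modulo null sets under each group element,
  so that ergodic means extreme among the invariant probability measures for every group,
  also an uncountable one.\<close>

definition ergodic_prob ::
  "('g, 'm) monoid_scheme \<Rightarrow> 'x topology \<Rightarrow> ('g \<Rightarrow> 'x \<Rightarrow> 'x) \<Rightarrow> 'x measure \<Rightarrow> bool" where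
  "ergodic_prob G X \<phi> \<mu> \<longleftrightarrow>
     invariant_prob G X \<phi> \<mu> \<and>
     (\<forall>A\<in>sets \<mu>.
        (\<forall>g\<in>carrier G. emeasure \<mu> (sym_diff (\<phi> g -` A \<inter> topspace X) A) = 0) \<longrightarrow>
        emeasure \<mu> A = 0 \<or> emeasure \<mu> A = 1)"

text \<open>On compact Hausdorff spaces that need not be metrizable, a probability measure is
  understood to be a regular Borel measure. On compact metrizable spaces regularity is automatic.\<close>

definition regular_measure :: "'x topology \<Rightarrow> 'x measure \<Rightarrow> bool" where
  "regular_measure X \<mu> \<longleftrightarrow>
     (\<forall>A\<in>sets \<mu>. emeasure \<mu> A = (SUP C\<in>{C. compactin X C \<and> C \<subseteq> A}. emeasure \<mu> C))"

text \<open>Amenability quantifies over all nonempty compact systems. HOL cannot quantify over types,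
  so the phase spaces are taken in \<^typ>\<open>('g \<Rightarrow> real) \<Rightarrow> real\<close>, the type of functionals on functions
  on the group. This loses no system. Every nonempty compact system contains a minimal one \<open>Y\<close>,
  in which some orbit map \<open>g \<mapsto> g y\<close> has dense image; as \<open>Y\<close> is Hausdorff and regular,
  \<open>z \<mapsto> {A. z \<in> closure (A y)}\<close> injects \<open>Y\<close> into \<^typ>\<open>'g set set\<close>, which in turn injects into
  the chosen type. An invariant regular measure on (a copy of) \<open>Y\<close> is one on the given system.\<close>

definition amenable_group :: "('g, 'm) monoid_scheme \<Rightarrow> 'g topology \<Rightarrow> bool" where
  "amenable_group G TG \<longleftrightarrow>
     (\<forall>(Y :: (('g \<Rightarrow> real) \<Rightarrow> real) topology) \<psi>.
        compact_system G TG Y \<psi> \<and> topspace Y \<noteq> {} \<longrightarrow>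
        (\<exists>\<nu>. invariant_prob G Y \<psi> \<nu> \<and> regular_measure Y \<nu>))"


section \<open>Haar measure and measure-theoretic isomorphism\<close>

text \<open>For compact Hausdorff \<open>Z\<close> the compact-open topology is the topology of uniform
  convergence.\<close>

definition homeo_topology :: "'z topology \<Rightarrow> ('z \<Rightarrow> 'z) topology" where
  "homeo_topology Z =
     topology_generated_by
       {{f \<in> extensional (topspace Z). homeomorphic_map Z Z f \<and> f ` C \<subseteq> U} | C U.
          compactin Z C \<and> openin Z U}"

definition enveloping_group ::
  "('g, 'm) monoid_scheme \<Rightarrow> 'z topology \<Rightarrow> ('g \<Rightarrow> 'z \<Rightarrow> 'z) \<Rightarrow> ('z \<Rightarrow> 'z) set" where
  "enveloping_group G Z \<psi> = homeo_topology Z closure_of (\<psi> ` carrier G)"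

definition enveloping_invariant_prob ::
  "('g, 'm) monoid_scheme \<Rightarrow> 'z topology \<Rightarrow> ('g \<Rightarrow> 'z \<Rightarrow> 'z) \<Rightarrow> 'z measure \<Rightarrow> bool" where
  "enveloping_invariant_prob G Z \<psi> \<mu> \<longleftrightarrow>
     borel_prob Z \<mu> \<and> (\<forall>k\<in>enveloping_group G Z \<psi>. distr \<mu> (borel_of Z) k = \<mu>)"

definition haar_measure ::
  "('g, 'm) monoid_scheme \<Rightarrow> 'z topology \<Rightarrow> ('g \<Rightarrow> 'z \<Rightarrow> 'z) \<Rightarrow> 'z measure \<Rightarrow> bool" where
  "haar_measure G Z \<psi> \<mu> \<longleftrightarrow>
     enveloping_invariant_prob G Z \<psi> \<mu> \<and>
     (\<forall>\<nu>. enveloping_invariant_prob G Z \<psi> \<nu> \<longrightarrow> \<nu> = \<mu>)"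

definition measure_isomorphism ::
  "('g, 'm) monoid_scheme \<Rightarrow> ('g \<Rightarrow> 'x \<Rightarrow> 'x) \<Rightarrow> 'x measure \<Rightarrow>
   ('g \<Rightarrow> 'z \<Rightarrow> 'z) \<Rightarrow> 'z measure \<Rightarrow> ('x \<Rightarrow> 'z) \<Rightarrow> bool" where
  "measure_isomorphism G \<phi> \<mu> \<psi> \<nu> \<iota> \<longleftrightarrow>
     (\<exists>X0\<in>sets \<mu>. \<exists>Z0\<in>sets \<nu>.
        emeasure \<mu> (space \<mu> - X0) = 0 \<and> emeasure \<nu> (space \<nu> - Z0) = 0 \<and>
        invariant_set G \<phi> X0 \<and> invariant_set G \<psi> Z0 \<and>
        bij_betw \<iota> X0 Z0 \<and>
        \<iota> \<in> measurable (restrict_space \<mu> X0) (restrict_space \<nu> Z0) \<and>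
        inv_into X0 \<iota> \<in> measurable (restrict_space \<nu> Z0) (restrict_space \<mu> X0) \<and>
        distr (restrict_space \<mu> X0) (restrict_space \<nu> Z0) \<iota> = restrict_space \<nu> Z0 \<and>
        (\<forall>g\<in>carrier G. \<forall>x\<in>X0. \<iota> (\<phi> g x) = \<psi> g (\<iota> x)))"

definition uniform_distribution :: "'x topology \<Rightarrow> 'x set \<Rightarrow> 'x measure" where
  "uniform_distribution X F = distr (uniform_count_measure F) (borel_of X) (\<lambda>x. x)"

end

theory Submission
  imports Defs
begin

text \<open>Call an open set \<open>U\<close> a half at \<open>w\<close> if it is clopen in the complement of \<open>w\<close>. Halves at distinct
  points of a connected space are nested, disjoint or cover the space, as components of complements
  of points in a dendrite would be, but no local connectedness is needed to work with them.
  An invariant measure \<open>\<mu>\<close> of full support on an infinite minimal set \<open>M\<close> has no atoms, and this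
  forces every point of \<open>M\<close> to lie in halves of arbitrarily small measure. Hence
  \<open>d x y = inf {\<mu> U | U half, x \<in> U, y \<in> U}\<close> is an invariant metric inducing the topology of \<open>M\<close>.
  So \<open>M\<close> is itself equicontinuous, and a measure invariant under a minimal isometric action gives
  all balls of the same radius the same mass, which determines it. For an ergodic \<open>\<mu>\<close> without atoms,
  finitely many translates of a small half meet all others, and small halves around a point keep away
  from any other point of the support. So the support contains no proper closed invariant subset.\<close>


section \<open>Halves\<close>

text \<open>The case distinction for two halves is what makes \<open>half_dist\<close> a metric.
  Halves with a common point are not disjoint, so they share the base and their union is a half, or
  one contains the other, or they cover the space and their measures add up to at least 1, the cap
  on all distances. The same four cases return in the ergodic argument, for a half and a translate
  of it. A half need not be connected or nonempty, so the halves at a fixed base are closed under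
  union, intersection and difference, which settles the case of a common base. What is always
  connected is \<open>insert w U\<close>, and this yields the other cases. Invariance of the metric
  is automatic, since its definition mentions only the topology and an invariant measure. A finite
  minimal set does have atoms, so halves meeting it cannot become small, and the discrete metric
  takes over there. Unions over all of \<open>G\<close> are measured for open sets only, so
  measurability survives an uncountable \<open>G\<close>.\<close>

definition half :: "'x topology \<Rightarrow> 'x \<Rightarrow> 'x set \<Rightarrow> bool" where
  "half X w U \<longleftrightarrow> openin X U \<and> w \<notin> U \<and> closedin X (insert w U)"

lemma half_subset: "half X w U \<Longrightarrow> insert w U \<subseteq> topspace X"
  unfolding half_def by (meson closedin_subset)

lemma half_Un: "half X w U \<Longrightarrow> half X w V \<Longrightarrow> half X w (U \<union> V)"
  unfolding half_def by (metis Un_iff Un_insert_left Un_insert_right closedin_Un insert_absorb2 openin_Un)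

lemma half_Int: "half X w U \<Longrightarrow> half X w V \<Longrightarrow> half X w (U \<inter> V)"
  unfolding half_def by (metis Int_iff Int_insert_left Int_insert_right closedin_Int insertI1 insert_absorb
      insert_inter_insert openin_Int)

lemma half_Compl:
  assumes "half X w U"
  shows "half X w (topspace X - insert w U)"
proof -
  have "insert w (topspace X - insert w U) = topspace X - U"
    using assms half_subset[OF assms] unfolding half_def by auto
  then show ?thesis
    using assms unfolding half_def by auto
qed

lemma half_Diff:
  assumes "half X w U" "half X w V"
  shows "half X w (U - V)"
proof -
  have "U - V = U \<inter> (topspace X - insert w V)"
    using assms(1) half_subset[OF assms(1)] unfolding half_def by auto
  then show ?thesis
    using half_Int[OF assms(1) half_Compl[OF assms(2)]] by simp
qed

text \<open>If \<open>insert w U\<close> splits into two relatively closed pieces, the piece without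
  \<open>w\<close> is closed as a part of \<open>insert w U\<close> and open as a part of
  \<open>U\<close>, hence clopen in the connected space \<open>X\<close>.\<close>

lemma connectedin_insert_half:
  assumes X: "connected_space X" and U: "half X w U"
  shows "connectedin X (insert w U)"
  unfolding connectedin_closedin
proof (intro conjI notI)
  show "insert w U \<subseteq> topspace X" by (rule half_subset[OF U])
  assume "\<exists>E1 E2. closedin X E1 \<and> closedin X E2 \<and> insert w U \<subseteq> E1 \<union> E2 \<and>
    E1 \<inter> E2 \<inter> insert w U = {} \<and> E1 \<inter> insert w U \<noteq> {} \<and> E2 \<inter> insert w U \<noteq> {}"
  then obtain E1 E2 where E: "closedin X E1" "closedin X E2" "insert w U \<subseteq> E1 \<union> E2"
    "E1 \<inter> E2 \<inter> insert w U = {}" "E1 \<inter> insert w U \<noteq> {}" "E2 \<inter> insert w U \<noteq> {}"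
    by blast
  have clopen: False if "closedin X P" "closedin X Q" "insert w U \<subseteq> P \<union> Q"
    "P \<inter> Q \<inter> insert w U = {}" "Q \<inter> insert w U \<noteq> {}" "w \<in> P" for P Q
  proof -
    have "w \<notin> Q" using that by auto
    have "closedin X (insert w U \<inter> Q)"
      using U that(2) unfolding half_def by blast
    moreover have "insert w U \<inter> Q = U - P"
      using that \<open>w \<notin> Q\<close> by auto
    moreover have "openin X (U - P)"
      using U that(1) unfolding half_def by blast
    ultimately have "U - P = {} \<or> U - P = topspace X"
      using X unfolding connected_space_clopen_in by metis
    then show False
      using that \<open>w \<notin> Q\<close> U half_subset[OF U] unfolding half_def by auto
  qed
  show False
    using clopen[of E1 E2] clopen[of E2 E1] E by auto
qed

text \<open>\<open>U\<close> and the opposite half at \<open>w\<close> are disjoint open sets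
  covering everything except \<open>w\<close>.\<close>

lemma connectedin_subset_half:
  assumes "connectedin X C" "half X w U" "w \<notin> C" "C \<inter> U \<noteq> {}"
  shows "C \<subseteq> U"
proof -
  have "openin X U" "openin X (topspace X - insert w U)"
    using assms(2) unfolding half_def by auto
  moreover have "C \<subseteq> topspace X"
    using assms(1) by (simp add: connectedin_subset_topspace)
  ultimately show ?thesis
    using assms(1,3,4) connectedinD[of X C U "topspace X - insert w U"] by blast
qed

text \<open>The connected set \<open>insert w' U'\<close> avoids \<open>w\<close> and meets
  \<open>U\<close> in \<open>w'\<close>.\<close>

lemma half_subset_half:
  assumes "connected_space X" "half X w U" "half X w' U'" "w \<notin> U'" "w' \<in> U"
  shows "insert w' U' \<subseteq> U"
  using connectedin_subset_half[OF connectedin_insert_half[OF assms(1,3)] assms(2)] assms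
  unfolding half_def by auto

text \<open>The connected set \<open>insert w U\<close> avoids \<open>w'\<close> and meets the half
  opposite to \<open>U'\<close> in \<open>w\<close>.\<close>

lemma half_disjoint_half:
  assumes X: "connected_space X" and U: "half X w U" "half X w' U'" and w: "w \<noteq> w'" "w \<notin> U'" "w' \<notin> U"
  shows "U \<inter> U' = {}"
proof -
  have "insert w U \<subseteq> topspace X - insert w' U'"
    using w U half_subset[OF U(1)]
    by (intro connectedin_subset_half[OF connectedin_insert_half[OF X U(1)] half_Compl[OF U(2)]])
      (auto simp: half_def)
  then show ?thesis by auto
qed

text \<open>Pass to the half opposite to \<open>U\<close>: it avoids \<open>w'\<close> and its base
  lies in \<open>U'\<close>, so it is contained in \<open>U'\<close>.\<close>

lemma half_cover_half:
  assumes X: "connected_space X" and U: "half X w U" "half X w' U'" and w: "w \<in> U'" "w' \<in> U"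
  shows "U \<union> U' = topspace X"
proof -
  have w': "w \<notin> U" "w' \<notin> U'" using U unfolding half_def by auto
  have "half X w (topspace X - insert w U)" by (rule half_Compl[OF U(1)])
  then have "insert w (topspace X - insert w U) \<subseteq> U'"
    using w by (intro half_subset_half[OF X U(2)]) auto
  then show ?thesis using half_subset[OF U(1)] half_subset[OF U(2)] by auto
qed

lemma half_homeomorphic_image:
  assumes "homeomorphic_map X Y f" "half X w U"
  shows "half Y (f w) (f ` U)"
proof -
  have "inj_on f (topspace X)" using assms(1) by (simp add: homeomorphic_imp_injective_map)
  then have "f w \<notin> f ` U"
    using half_subset[OF assms(2)] assms(2) unfolding half_def inj_on_def by auto
  moreover have "closedin Y (f ` insert w U)" "openin Y (f ` U)"
    using assms half_subset[OF assms(2)] unfolding half_def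
    by (auto simp del: image_insert intro: homeomorphic_map_closedness_eq[THEN iffD1]
        dest: homeomorphic_map_openness_eq homeomorphic_map_closedness_eq)
  ultimately show ?thesis unfolding half_def by simp
qed

text \<open>The separation property of a dendron enters the proof only in this form. Each side of a
  separating point is a half because its union with that point is the complement of the other
  side.\<close>

lemma dendron_half_separation:
  assumes "dendron X" "x \<in> topspace X" "y \<in> topspace X" "x \<noteq> y"
  obtains z A B where "half X z A" "half X z B" "A \<inter> B = {}" "x \<in> A" "y \<in> B"
    "A \<union> B = topspace X - {z}" "z \<in> topspace X"
proof -
  obtain z A B where z: "z \<in> topspace X" "openin X A" "openin X B" "A \<inter> B = {}"
    "A \<union> B = topspace X - {z}" "x \<in> A" "y \<in> B"
    using assms unfolding dendron_def by meson
  have "insert z A = topspace X - B" "insert z B = topspace X - A"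
    using z openin_subset[OF z(2)] openin_subset[OF z(3)] by auto
  then have "half X z A" "half X z B"
    using z unfolding half_def by auto
  then show thesis using that z by blast
qed

text \<open>A half containing \<open>x\<close> and \<open>y\<close> may be based at one point separating them, which is why two separating
  points, with the sides \<open>A\<close> and \<open>A'\<close> of \<open>x\<close>, are used.\<close>

lemma dendron_half_lower_bound:
  assumes X: "dendron X" and xy: "x \<in> topspace X" "y \<in> topspace X" "x \<noteq> y"
  obtains A A' B where "openin X A" "openin X A'" "openin X B"
    "x \<in> A" "x \<in> A'" "y \<in> B"
    "\<And>w U. half X w U \<Longrightarrow> x \<in> U \<Longrightarrow> U \<inter> B \<noteq> {} \<Longrightarrow> A \<subseteq> U \<or> A' \<subseteq> U \<or> B \<subseteq> U"
proof -
  have conn: "connected_space X" using X unfolding dendron_def by blast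
  obtain z A B where z: "half X z A" "half X z B" "A \<inter> B = {}" "x \<in> A" "y \<in> B"
    "A \<union> B = topspace X - {z}" "z \<in> topspace X"
    using dendron_half_separation[OF X xy] by blast
  have "x \<noteq> z" using z unfolding half_def by auto
  then obtain z' A' B' where z': "half X z' A'" "half X z' B'" "A' \<inter> B' = {}" "x \<in> A'" "z \<in> B'"
    "A' \<union> B' = topspace X - {z'}" "z' \<in> topspace X"
    using dendron_half_separation[OF X xy(1) z(7)] by blast
  have "z' \<noteq> z" using z' unfolding half_def by auto
  \<comment> \<open>Otherwise \<open>A\<close> and \<open>A'\<close> would be disjoint by
    \<open>half_disjoint_half\<close>, but both contain \<open>x\<close>.\<close>
  have "z' \<in> A"
    using half_disjoint_half[OF conn z(1) z'(1)] z z' \<open>z' \<noteq> z\<close> by blast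
  have "z' \<notin> B" using \<open>z' \<in> A\<close> z by auto
  have BB: "insert z B \<subseteq> B'"
    using half_subset_half[OF conn z'(2) z(2)] \<open>z' \<notin> B\<close> z' by blast
  \<comment> \<open>Here \<open>p\<close> separates \<open>x\<close> from \<open>B\<close>. Since
    \<open>insert w U\<close> is connected and reaches both sides, it contains \<open>p\<close>;
    then \<open>U\<close> swallows whichever side of \<open>p\<close> does not contain
    \<open>w\<close>.\<close>
  have bound: "C \<subseteq> U \<or> B \<subseteq> U" 
    if "half X p C" "half X p D" "C \<inter> D = {}" "x \<in> C" "insert z B \<subseteq> insert p D"
       "half X w U" "x \<in> U" "U \<inter> B \<noteq> {}" "w \<noteq> p" "C \<union> D = topspace X - {p}" "B \<subseteq> D" for p C D w U
  proof -
    have U: "connectedin X (insert w U)" using connectedin_insert_half[OF conn that(6)] .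
    have "p \<in> insert w U"
      using connectedin_subset_half[OF U that(1)] that by blast
    then have "p \<in> U" using \<open>w \<noteq> p\<close> by auto
    have "w \<in> topspace X" using half_subset[OF that(6)] by auto
    then have "w \<in> C \<or> w \<in> D" using that by blast
    then show ?thesis
    proof
      assume "w \<in> C"
      then have "insert p D \<subseteq> U"
        using half_subset_half[OF conn that(6,2)] \<open>p \<in> U\<close> that(3) by blast
      then show ?thesis using that by auto
    next
      assume "w \<in> D"
      then have "insert p C \<subseteq> U"
        using half_subset_half[OF conn that(6,1)] \<open>p \<in> U\<close> that(3) by blast
      then show ?thesis using that by auto
    qed
  qed
  \<comment> \<open>The bound needs a separating point other than the base \<open>w\<close>:
    \<open>z\<close> in general, and \<open>z'\<close> if \<open>w\<close> happens to be
    \<open>z\<close>.\<close>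
  have "A \<subseteq> U \<or> A' \<subseteq> U \<or> B \<subseteq> U" if "half X w U" "x \<in> U" "U \<inter> B \<noteq> {}" for w U
  proof (cases "w = z")
    case True
    then show ?thesis
      using bound[OF z'(1,2,3,4) _ that _ z'(6)] BB \<open>z' \<noteq> z\<close> by blast
  next
    case False
    then show ?thesis
      using bound[OF z(1,2,3,4) _ that _ z(6)] by blast
  qed
  then show thesis
    using that[of A A' B] z z' unfolding half_def by blast
qed


section \<open>Halves of small measure\<close>

lemma space_borel_of [simp]: "space (borel_of X) = topspace X"
  unfolding borel_of_def by (rule space_measure_of) (auto dest: openin_subset)

lemma sets_borel_of: "sets (borel_of X) = sigma_sets (topspace X) {U. openin X U}"
  unfolding borel_of_def by (intro sets_measure_of) (auto dest: openin_subset)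

lemma openin_in_sets_borel_of: "openin X U \<Longrightarrow> U \<in> sets (borel_of X)"
  unfolding sets_borel_of by auto

lemma closedin_in_sets_borel_of:
  assumes "closedin X C"
  shows "C \<in> sets (borel_of X)"
proof -
  have "C = space (borel_of X) - (topspace X - C)"
    using closedin_subset[OF assms] by auto
  then show ?thesis
    using openin_in_sets_borel_of[of X "topspace X - C"] assms by (metis closedin_def sets.compl_sets)
qed

lemma continuous_map_measurable:
  assumes "continuous_map X Y f"
  shows "f \<in> measurable (borel_of X) (borel_of Y)"
  unfolding borel_of_def[of Y]
proof (rule measurable_measure_of)
  show "f \<in> space (borel_of X) \<rightarrow> topspace Y"
    using continuous_map_image_subset_topspace[OF assms] by auto
  show "f -` U \<inter> space (borel_of X) \<in> sets (borel_of X)" if "U \<in> {U. openin Y U}" for U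
  proof -
    have "f -` U \<inter> space (borel_of X) = {x \<in> topspace X. f x \<in> U}" by auto
    moreover have "openin X {x \<in> topspace X. f x \<in> U}"
      using openin_continuous_map_preimage[OF assms] that by simp
    ultimately show ?thesis
      using openin_in_sets_borel_of by metis
  qed
qed (auto dest: openin_subset)

lemma
  assumes "borel_prob X \<mu>"
  shows borel_prob_prob_space: "prob_space \<mu>"
    and sets_borel_prob: "sets \<mu> = sets (borel_of X)"
    and space_borel_prob: "space \<mu> = topspace X"
  using assms sets_eq_imp_space_eq[of \<mu> "borel_of X"] unfolding borel_prob_def by auto

lemma
  assumes "borel_prob X \<mu>"
  shows openin_in_sets_borel_prob: "openin X U \<Longrightarrow> U \<in> sets \<mu>"
    and closedin_in_sets_borel_prob: "closedin X U \<Longrightarrow> U \<in> sets \<mu>"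
  using assms by (auto simp: sets_borel_prob openin_in_sets_borel_of closedin_in_sets_borel_of)

text \<open>Directedness reduces finite intersections to single members. \<open>E\<close> is a
  parameter because one family will be intersected with two closed sets: first \<open>S\<close>,
  then the part of \<open>S\<close> outside a neighbourhood.\<close>

lemma compact_space_directed_Inter:
  assumes X: "compact_space X" and ne: "\<K> \<noteq> {}" and E: "closedin X E"
    and closed: "\<And>K. K \<in> \<K> \<Longrightarrow> closedin X K"
    and meet: "\<And>K. K \<in> \<K> \<Longrightarrow> K \<inter> E \<noteq> {}"
    and dir: "\<And>K L. K \<in> \<K> \<Longrightarrow> L \<in> \<K> \<Longrightarrow> \<exists>M\<in>\<K>. M \<subseteq> K \<inter> L"
  obtains b where "b \<in> E" "\<And>K. K \<in> \<K> \<Longrightarrow> b \<in> K"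
proof -
  have below: "\<exists>K\<in>\<K>. K \<inter> E \<subseteq> \<Inter>F" if "finite F" "F \<subseteq> (\<lambda>K. K \<inter> E) ` \<K>" for F
    using that
  proof (induction F rule: finite_induct)
    case empty
    then show ?case using ne by auto
  next
    case (insert D F)
    then obtain K L where K: "K \<in> \<K>" "K \<inter> E \<subseteq> \<Inter>F" and L: "L \<in> \<K>" "D = L \<inter> E" by auto
    obtain M where "M \<in> \<K>" "M \<subseteq> K \<inter> L" using dir[OF K(1) L(1)] by auto
    then show ?case using K(2) L(2) by (intro bexI[of _ M]) auto
  qed
  have "\<Inter>F \<noteq> {}" if F: "finite F" "F \<subseteq> (\<lambda>K. K \<inter> E) ` \<K>" for F
  proof -
    obtain K where "K \<in> \<K>" "K \<inter> E \<subseteq> \<Inter>F" using below[OF F] by auto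
    then show ?thesis using meet[of K] by auto
  qed
  moreover have "closedin X C" if "C \<in> (\<lambda>K. K \<inter> E) ` \<K>" for C
    using that closed E by auto
  ultimately have "\<Inter>((\<lambda>K. K \<inter> E) ` \<K>) \<noteq> {}"
    using X[unfolded compact_space_fip, rule_format, of "(\<lambda>K. K \<inter> E) ` \<K>"] by presburger
  then obtain b where "b \<in> \<Inter>((\<lambda>K. K \<inter> E) ` \<K>)" by auto
  then show thesis using that[of b] ne by auto
qed

lemma (in Metric_space) mball_Inter_sing:
  assumes "x \<in> M"
  shows "(\<Inter>n::nat. mball x (1 / Suc n)) = {x}"
proof -
  have "y = x" if "\<And>n::nat. y \<in> mball x (1 / Suc n)" for y
  proof (rule ccontr)
    assume "y \<noteq> x"
    then have "0 < d x y" using that[of 0] by auto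
    then obtain n :: nat where "1 / Suc n < d x y" using nat_approx_posE by blast
    then show False using that[of n] by auto
  qed
  then show ?thesis using assms by auto
qed

lemma borel_prob_small_open:
  assumes X: "metrizable_space X" and \<mu>: "borel_prob X \<mu>" and x: "x \<in> topspace X" "measure \<mu> {x} < e"
  obtains B where "openin X B" "x \<in> B" "measure \<mu> B < e"
proof -
  obtain M d where Md: "Metric_space M d" "X = Metric_space.mtopology M d"
    using X unfolding metrizable_space_def by blast
  interpret Metric_space M d by fact
  interpret prob_space \<mu> by (rule borel_prob_prob_space[OF \<mu>])
  have "x \<in> M" using x Md by simp
  define B where "B n = mball x (1 / Suc n)" for n :: nat
  have B: "openin X (B n)" for n unfolding B_def using Md by simp
  have "B n \<subseteq> B m" if "m \<le> n" for m n
    unfolding B_def using that by (intro mball_subset_concentric) (simp add: frac_le)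
  then have "decseq B" by (simp add: antimono_def)
  then have "(\<lambda>n. measure \<mu> (B n)) \<longlonglongrightarrow> measure \<mu> (\<Inter>n. B n)"
    using B openin_in_sets_borel_prob[OF \<mu>] by (intro finite_Lim_measure_decseq) auto
  also have "(\<Inter>n. B n) = {x}" unfolding B_def by (rule mball_Inter_sing[OF \<open>x \<in> M\<close>])
  finally have "eventually (\<lambda>n. measure \<mu> (B n) < e) sequentially"
    using x by (simp add: order_tendstoD)
  then obtain n where "measure \<mu> (B n) < e" by (auto simp: eventually_sequentially)
  moreover have "x \<in> B n" unfolding B_def using \<open>x \<in> M\<close> by simp
  ultimately show thesis using that B by blast
qed

lemma half_in_sets: "borel_prob X \<mu> \<Longrightarrow> half X w U \<Longrightarrow> U \<in> sets \<mu>"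
  unfolding half_def by (auto intro: openin_in_sets_borel_prob)

text \<open>If the measures of the halves meeting \<open>S\<close> had a positive infimum \<open>m\<close>, then a half of measure
  below \<open>2 m\<close> would not contain two disjoint ones. The halves inside it would then shrink to a
  single point of \<open>S\<close>, necessarily an atom.\<close>

proposition dendrite_small_half:
  assumes X: "dendrite X" and \<mu>: "borel_prob X \<mu>"
    and S: "closedin X S" "measure \<mu> S = 1"
    and supp: "\<And>U. openin X U \<Longrightarrow> U \<inter> S \<noteq> {} \<Longrightarrow> 0 < measure \<mu> U"
    and atomless: "\<And>x. x \<in> S \<Longrightarrow> measure \<mu> {x} = 0"
    and "0 < e"
  shows "\<exists>w U. half X w U \<and> U \<inter> S \<noteq> {} \<and> measure \<mu> U < e"
proof (rule ccontr)
  assume "\<not> ?thesis"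
  then have large: "e \<le> measure \<mu> U" if "half X w U" "U \<inter> S \<noteq> {}" for w U
    using that by force
  interpret prob_space \<mu> by (rule borel_prob_prob_space[OF \<mu>])
  note sets = half_in_sets[OF \<mu>]
  have D: "dendron X" and metr: "metrizable_space X" and conn: "connected_space X"
    and comp: "compact_space X" and SX: "S \<subseteq> topspace X"
    using X S closedin_subset unfolding dendrite_def dendron_def by auto
  have mS: "measure \<mu> (A \<inter> S) = measure \<mu> A" if "A \<in> sets \<mu>" for A
  proof -
    have S': "S \<in> sets \<mu>" using closedin_in_sets_borel_prob[OF \<mu> S(1)] .
    then have "measure \<mu> (space \<mu> - S) = 0" using S(2) prob_compl by simp
    moreover have "measure \<mu> (A - S) \<le> measure \<mu> (space \<mu> - S)"
      using S' sets.sets_into_space[OF that] by (intro finite_measure_mono) auto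
    ultimately have "measure \<mu> (A - S) = 0"
      using measure_nonneg[of \<mu> "A - S"] by linarith
    then show ?thesis
      using finite_measure_Union[of "A \<inter> S" "A - S"] that S' by (simp add: Int_Diff_Un Int_Diff_disjoint)
  qed
  \<comment> \<open>A single point of \<open>S\<close> in \<open>A\<close> would carry the whole
    positive measure of \<open>A\<close> and be an atom.\<close>
  have two: "\<exists>x\<in>A \<inter> S. \<exists>y\<in>A \<inter> S. x \<noteq> y" if A: "openin X A" "A \<inter> S \<noteq> {}" for A
  proof (rule ccontr)
    assume "\<not> ?thesis"
    then obtain x where "A \<inter> S = {x}" using A(2) by blast
    then show False
      using mS[of A] supp[OF A] atomless[of x] openin_in_sets_borel_prob[OF \<mu> A(1)] by auto
  qed
  define F where "F = {U. (\<exists>w. half X w U) \<and> U \<inter> S \<noteq> {}}"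
  define m where "m = Inf (measure \<mu> ` F)"
  have "S \<noteq> {}" using S(2) by auto
  then obtain x y where "x \<in> S" "y \<in> S" "x \<noteq> y" using two[of "topspace X"] SX by auto
  moreover have "x \<in> topspace X" "y \<in> topspace X" using SX calculation by auto
  ultimately obtain z A where "half X z A" "x \<in> A"
    using dendron_half_separation[OF D] by metis
  then have "F \<noteq> {}" using \<open>x \<in> S\<close> unfolding F_def by auto
  then have "e \<le> m" unfolding m_def
    using large by (intro cInf_greatest) (auto simp: F_def)
  then have "0 < m" using \<open>0 < e\<close> by simp
  have m: "m \<le> measure \<mu> U" if "half X w U" "U \<inter> S \<noteq> {}" for w U
    unfolding m_def using that by (intro cInf_lower bdd_belowI[of _ 0]) (auto simp: F_def)
  \<comment> \<open>Below \<open>2 * m\<close> there is no room in \<open>U\<close> for two disjoint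
    halves meeting \<open>S\<close>, each of measure at least \<open>m\<close>.\<close>
  have "Inf (measure \<mu> ` F) < 2 * m" using \<open>0 < m\<close> unfolding m_def by linarith
  then obtain U w where U: "half X w U" "U \<inter> S \<noteq> {}" "measure \<mu> U < 2 * m"
    using cInf_lessD[of "measure \<mu> ` F" "2 * m"] \<open>F \<noteq> {}\<close> unfolding F_def by blast
  have "w \<notin> U" using U unfolding half_def by simp
  have nodisj: "A \<inter> B \<noteq> {}" if "half X a A" "half X b B" "A \<subseteq> U" "B \<subseteq> U" "A \<inter> S \<noteq> {}" "B \<inter> S \<noteq> {}" for a A b B
  proof
    assume "A \<inter> B = {}"
    then have "measure \<mu> A + measure \<mu> B = measure \<mu> (A \<union> B)"
      using finite_measure_Union[of A B] that sets by metis
    also have "\<dots> \<le> measure \<mu> U"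
      using finite_measure_mono[of "A \<union> B" U] that sets[OF U(1)] by auto
    finally show False using U(3) m[OF that(1,5)] m[OF that(2,6)] by simp
  qed
  have inside: "insert z C \<subseteq> U" if "half X z C" "w \<notin> insert z C" "p \<in> C" "p \<in> U" for z C p
    using connectedin_subset_half[OF connectedin_insert_half[OF conn that(1)] U(1) that(2)] that(3,4) by blast
  \<comment> \<open>The base points are added to make the members closed for the compactness
    argument, and they too must lie in \<open>U\<close>.\<close>
  define \<K> where "\<K> = {insert z A | z A. half X z A \<and> insert z A \<subseteq> U \<and> A \<inter> S \<noteq> {}}"
  have separate: "\<exists>K\<in>\<K>. x \<notin> K \<or> y \<notin> K" if xy: "x \<in> U \<inter> S" "y \<in> U \<inter> S" "x \<noteq> y" for x y
  proof -
    obtain z A B where z: "half X z A" "half X z B" "A \<inter> B = {}" "x \<in> A" "y \<in> B"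
      "A \<union> B = topspace X - {z}" "z \<in> topspace X"
      using dendron_half_separation[OF D, of x y] xy SX by blast
    have z': "z \<notin> A" "z \<notin> B" using z unfolding half_def by auto
    \<comment> \<open>A separating point equal to the base of \<open>U\<close> would cut
      \<open>U\<close> into two disjoint halves at \<open>w\<close> that both meet
      \<open>S\<close>.\<close>
    have "w \<noteq> z"
    proof
      assume "w = z"
      then have "half X w (U \<inter> A)" "half X w (U \<inter> B)" using half_Int[OF U(1)] z(1,2) by auto
      moreover have "U \<inter> A \<inter> S \<noteq> {}" "U \<inter> B \<inter> S \<noteq> {}" using xy z(4,5) by auto
      ultimately have "U \<inter> A \<inter> (U \<inter> B) \<noteq> {}"
        using nodisj[of w "U \<inter> A" w "U \<inter> B"] by simp
      then show False using z by auto
    qed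
    moreover have "w \<in> topspace X" using half_subset[OF U(1)] by simp
    ultimately have "w \<in> A \<or> w \<in> B" using z by blast
    then show ?thesis
    proof
      assume "w \<in> A"
      then have "w \<notin> insert z B" using \<open>w \<noteq> z\<close> z(3) by auto
      then have "insert z B \<subseteq> U"
        using inside[OF z(2) _ z(5)] xy by simp
      moreover have "B \<inter> S \<noteq> {}" using xy z(4,5) by auto
      ultimately have "insert z B \<in> \<K>" using z(2) unfolding \<K>_def by (intro CollectI exI conjI) (rule refl | assumption)+
      moreover have "x \<notin> insert z B" using z(3,4,5) z' by auto
      ultimately show ?thesis by (intro bexI[of _ "insert z B"] disjI1)
    next
      assume "w \<in> B"
      then have "w \<notin> insert z A" using \<open>w \<noteq> z\<close> z(3) by auto
      then have "insert z A \<subseteq> U"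
        using inside[OF z(1) _ z(4)] xy by simp
      moreover have "A \<inter> S \<noteq> {}" using xy z(4,5) by auto
      ultimately have "insert z A \<in> \<K>" using z(1) unfolding \<K>_def by (intro CollectI exI conjI) (rule refl | assumption)+
      moreover have "y \<notin> insert z A" using z(3,4,5) z' by auto
      ultimately show ?thesis by (intro bexI[of _ "insert z A"] disjI2)
    qed
  qed
  have directed: "\<exists>M\<in>\<K>. M \<subseteq> K \<inter> L" if KL: "K \<in> \<K>" "L \<in> \<K>" for K L
  proof -
    obtain z A where A: "K = insert z A" "half X z A" "insert z A \<subseteq> U" "A \<inter> S \<noteq> {}"
      using KL(1) unfolding \<K>_def by blast
    obtain y B where B: "L = insert y B" "half X y B" "insert y B \<subseteq> U" "B \<inter> S \<noteq> {}"
      using KL(2) unfolding \<K>_def by blast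
    show ?thesis
    proof (cases "y = z")
      case True
      \<comment> \<open>If the common part missed \<open>S\<close>, the two differences would be
        disjoint halves inside \<open>U\<close> that still meet \<open>S\<close>.\<close>
      have "A \<inter> B \<inter> S \<noteq> {}"
      proof
        assume *: "A \<inter> B \<inter> S = {}"
        have "half X z (A - B)" "half X z (B - A)" using half_Diff[of X z A B] half_Diff[of X z B A] A(2) B(2) True by simp_all
        moreover have "A - B \<subseteq> U" "B - A \<subseteq> U" "(A - B) \<inter> S \<noteq> {}" "(B - A) \<inter> S \<noteq> {}"
          using A(3,4) B(3,4) * by auto
        ultimately have "(A - B) \<inter> (B - A) \<noteq> {}"
          by (rule nodisj)
        then show False by auto
      qed
      moreover have "half X z (A \<inter> B)" "insert z (A \<inter> B) \<subseteq> U"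
        using half_Int[of X z A B] A(2,3) B(2) True by auto
      ultimately have "insert z (A \<inter> B) \<in> \<K>"
        unfolding \<K>_def by (intro CollectI exI conjI) (rule refl | assumption)+
      then show ?thesis using A(1) B(1) True by (intro bexI[of _ "insert z (A \<inter> B)"]) auto
    next
      case False
      \<comment> \<open>Of the cases for distinct bases only nesting survives: disjointness is ruled
        out by \<open>nodisj\<close>, and covering because both halves lie in \<open>U\<close>,
        which misses \<open>w\<close>.\<close>
      have "A \<inter> B \<noteq> {}" using nodisj[OF A(2) B(2)] A(3,4) B(3,4) by simp
      then have "z \<in> B \<or> y \<in> A"
        using half_disjoint_half[OF conn A(2) B(2)] False by blast
      moreover have "\<not> (z \<in> B \<and> y \<in> A)"
        using half_cover_half[OF conn A(2) B(2)] A(3) B(3) \<open>w \<notin> U\<close> half_subset[OF U(1)] by blast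
      ultimately consider "z \<in> B" "y \<notin> A" | "y \<in> A" "z \<notin> B" by blast
      then show ?thesis
      proof cases
        case 1
        then have "K \<subseteq> L" using half_subset_half[OF conn B(2) A(2)] A(1) B(1) by auto
        then show ?thesis using KL(1) by blast
      next
        case 2
        then have "L \<subseteq> K" using half_subset_half[OF conn A(2) B(2)] A(1) B(1) by auto
        then show ?thesis using KL(2) by blast
      qed
    qed
  qed
  have \<K>: "closedin X K" "K \<inter> S \<noteq> {}" "K \<subseteq> U" "m \<le> measure \<mu> K" if K: "K \<in> \<K>" for K
  proof -
    obtain z A where A: "K = insert z A" "half X z A" "insert z A \<subseteq> U" "A \<inter> S \<noteq> {}"
      using K unfolding \<K>_def by blast
    then show *: "closedin X K" "K \<inter> S \<noteq> {}" "K \<subseteq> U" unfolding half_def by auto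
    have "measure \<mu> A \<le> measure \<mu> K"
      using A closedin_in_sets_borel_prob[OF \<mu> *(1)] by (intro finite_measure_mono) auto
    then show "m \<le> measure \<mu> K" using m[OF A(2,4)] by simp
  qed
  obtain x y where xy: "x \<in> U \<inter> S" "y \<in> U \<inter> S" "x \<noteq> y"
    using two[of U] U unfolding half_def by blast
  then have "\<K> \<noteq> {}" using separate by blast
  obtain b where b: "b \<in> S" "\<And>K. K \<in> \<K> \<Longrightarrow> b \<in> K"
    using compact_space_directed_Inter[OF comp \<open>\<K> \<noteq> {}\<close> S(1) \<K>(1,2) directed] by metis
  then have "b \<in> U \<inter> S" using \<K>(3) \<open>\<K> \<noteq> {}\<close> by auto
  have only_b: "y = b" if y: "y \<in> S" "\<And>K. K \<in> \<K> \<Longrightarrow> y \<in> K" for y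
  proof (rule ccontr)
    assume "y \<noteq> b"
    moreover have "y \<in> U \<inter> S" using y \<K>(3) \<open>\<K> \<noteq> {}\<close> by auto
    ultimately obtain K where "K \<in> \<K>" "y \<notin> K \<or> b \<notin> K"
      using separate[of y b] \<open>b \<in> U \<inter> S\<close> by blast
    then show False using y(2)[of K] b(2)[of K] by auto
  qed
  \<comment> \<open>Since \<open>b\<close> is not an atom, it has a neighbourhood of measure below
    \<open>m\<close>. By compactness some member of \<open>\<K>\<close> has its
    \<open>S\<close>-part in that neighbourhood, although this part has measure at least
    \<open>m\<close>.\<close>
  obtain B where B: "openin X B" "b \<in> B" "measure \<mu> B < m"
    using borel_prob_small_open[OF metr \<mu>, of b m] atomless \<open>b \<in> U \<inter> S\<close> SX \<open>0 < m\<close> by force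
  have "\<exists>K\<in>\<K>. K \<inter> S \<subseteq> B"
  proof (rule ccontr)
    assume notin: "\<not> ?thesis"
    have "K \<inter> (S - B) \<noteq> {}" if "K \<in> \<K>" for K using notin that by auto
    moreover have "closedin X (S - B)" using S B by blast
    ultimately obtain y where y: "y \<in> S - B" "\<And>K. K \<in> \<K> \<Longrightarrow> y \<in> K"
      using compact_space_directed_Inter[OF comp \<open>\<K> \<noteq> {}\<close> _ \<K>(1) _ directed, of "S - B"] by metis
    then have "y = b" using only_b[of y] by simp
    then show False using y B(2) by simp
  qed
  then obtain K where K: "K \<in> \<K>" "K \<inter> S \<subseteq> B" by blast
  have "m \<le> measure \<mu> (K \<inter> S)"
    using \<K>[OF K(1)] mS closedin_in_sets_borel_prob[OF \<mu>] by simp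
  also have "\<dots> \<le> measure \<mu> B"
    using K openin_in_sets_borel_prob[OF \<mu> B(1)] by (intro finite_measure_mono) auto
  finally show False using B(3) by simp
qed


section \<open>The metric defined by halves\<close>

text \<open>Each of the three open sets from \<open>dendron_half_lower_bound\<close> contains
  \<open>x\<close> or \<open>y\<close>, so its measure is positive, and \<delta> is the least of
  these. All halves meeting a neighbourhood of \<open>y\<close> are treated, so that finitely many
  neighbourhoods can later cover a compact set.\<close>

lemma half_measure_separation:
  assumes X: "dendron X" and \<mu>: "borel_prob X \<mu>"
    and supp: "\<And>U. openin X U \<Longrightarrow> U \<inter> S \<noteq> {} \<Longrightarrow> 0 < measure \<mu> U"
    and xy: "x \<in> S" "y \<in> S" "x \<noteq> y" and S: "S \<subseteq> topspace X"
  obtains \<delta> B where "0 < \<delta>" "openin X B" "y \<in> B"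
    "\<And>w U. half X w U \<Longrightarrow> x \<in> U \<Longrightarrow> U \<inter> B \<noteq> {} \<Longrightarrow> \<delta> \<le> measure \<mu> U"
proof -
  interpret prob_space \<mu> by (rule borel_prob_prob_space[OF \<mu>])
  have "x \<in> topspace X" "y \<in> topspace X" using xy S by auto
  then obtain A A' B where AB: "openin X A" "openin X A'" "openin X B" "x \<in> A" "x \<in> A'" "y \<in> B"
    and bound: "\<And>w U. half X w U \<Longrightarrow> x \<in> U \<Longrightarrow> U \<inter> B \<noteq> {} \<Longrightarrow> A \<subseteq> U \<or> A' \<subseteq> U \<or> B \<subseteq> U"
    using dendron_half_lower_bound[OF X _ _ xy(3)] by metis
  define \<delta> where "\<delta> = min (measure \<mu> A) (min (measure \<mu> A') (measure \<mu> B))"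
  have "0 < measure \<mu> A" using AB xy by (intro supp) auto
  moreover have "0 < measure \<mu> A'" using AB xy by (intro supp) auto
  moreover have "0 < measure \<mu> B" using AB xy by (intro supp) auto
  ultimately have "0 < \<delta>" unfolding \<delta>_def by simp
  moreover have "\<delta> \<le> measure \<mu> U" if "half X w U" "x \<in> U" "U \<inter> B \<noteq> {}" for w U
    using bound[OF that] half_in_sets[OF \<mu> that(1)] finite_measure_mono[of _ U]
    unfolding \<delta>_def by (auto simp: min_le_iff_disj)
  ultimately show thesis using that AB by blast
qed

text \<open>The value \<open>1\<close> stands for the whole space and keeps the infimum from ranging over the empty set.\<close>

definition half_dist :: "'x topology \<Rightarrow> 'x measure \<Rightarrow> 'x \<Rightarrow> 'x \<Rightarrow> real" where
  "half_dist X \<mu> x y =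
     (if x = y then 0 else Inf (insert 1 {measure \<mu> U | w U. half X w U \<and> x \<in> U \<and> y \<in> U}))"

lemma half_dist_bdd_below: "bdd_below (insert 1 {measure \<mu> U | w U. half X w U \<and> x \<in> U \<and> y \<in> U})"
  by (rule bdd_belowI[of _ 0]) auto

lemma half_dist_le_1: "half_dist X \<mu> x y \<le> 1"
  unfolding half_dist_def by (auto intro!: cInf_lower half_dist_bdd_below)

lemma half_dist_le:
  assumes "half X w U" "x \<in> U" "y \<in> U"
  shows "half_dist X \<mu> x y \<le> measure \<mu> U"
proof (cases "x = y")
  case False
  have "measure \<mu> U \<in> insert 1 {measure \<mu> U | w U. half X w U \<and> x \<in> U \<and> y \<in> U}"
    using assms by blast
  then show ?thesis
    using cInf_lower[OF _ half_dist_bdd_below] False unfolding half_dist_def by (simp only: if_False)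
qed (simp add: half_dist_def)

lemma half_dist_greatest:
  assumes "x \<noteq> y" "c \<le> 1" "\<And>w U. half X w U \<Longrightarrow> x \<in> U \<Longrightarrow> y \<in> U \<Longrightarrow> c \<le> measure \<mu> U"
  shows "c \<le> half_dist X \<mu> x y"
  unfolding half_dist_def using assms by (auto intro!: cInf_greatest)

lemma half_dist_nonneg: "0 \<le> half_dist X \<mu> x y"
  by (cases "x = y") (auto simp: half_dist_def[of _ _ y] intro: half_dist_greatest)

lemma half_dist_sym: "half_dist X \<mu> x y = half_dist X \<mu> y x"
  unfolding half_dist_def by (simp add: conj_commute)

lemma half_dist_lessE:
  assumes "half_dist X \<mu> x y < r" "x \<noteq> y" "r \<le> 1"
  obtains w U where "half X w U" "x \<in> U" "y \<in> U" "measure \<mu> U < r"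
proof -
  have "Inf (insert 1 {measure \<mu> U | w U. half X w U \<and> x \<in> U \<and> y \<in> U}) < r"
    using assms(1,2) unfolding half_dist_def by simp
  from cInf_lessD[OF _ this] show thesis using that assms(3) by auto
qed

text \<open>Two halves nearly realizing the distances on the right both contain \<open>y\<close>, so
  they are not disjoint. In the cases of a common base or of nesting, their union is a half
  containing \<open>x\<close> and \<open>z\<close>; if they cover the space, their measures sum to
  at least 1.\<close>

lemma half_dist_triangle:
  assumes conn: "connected_space X" and \<mu>: "borel_prob X \<mu>"
  shows "half_dist X \<mu> x z \<le> half_dist X \<mu> x y + half_dist X \<mu> y z"
proof (rule ccontr)
  assume neg: "\<not> ?thesis"
  interpret prob_space \<mu> by (rule borel_prob_prob_space[OF \<mu>])
  \<comment> \<open>Half of the supposed gap goes to each summand, so that \<open>r + s\<close> is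
    exactly the distance on the left.\<close>
  define t where "t = (half_dist X \<mu> x z - half_dist X \<mu> x y - half_dist X \<mu> y z) / 2"
  define r where "r = half_dist X \<mu> x y + t"
  define s where "s = half_dist X \<mu> y z + t"
  have "0 < t" using neg unfolding t_def by simp
  have rs: "r + s = half_dist X \<mu> x z" unfolding r_def s_def t_def by simp
  have pos: "0 < r" "0 < s" using \<open>0 < t\<close> half_dist_nonneg[of X \<mu>] unfolding r_def s_def by (smt (verit))+
  \<comment> \<open>With thresholds at most 1, the default value 1 in the infimum cannot be what
    lies below them, so actual halves exist.\<close>
  have le1: "r \<le> 1" "s \<le> 1" using rs pos half_dist_le_1[of X \<mu> x z] by linarith+
  have "x \<noteq> y" "y \<noteq> z" using neg by (auto simp: half_dist_def)
  obtain u U where U: "half X u U" "x \<in> U" "y \<in> U" "measure \<mu> U < r"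
    using half_dist_lessE[of X \<mu> x y r] \<open>x \<noteq> y\<close> le1 \<open>0 < t\<close> unfolding r_def by auto
  obtain v V where V: "half X v V" "y \<in> V" "z \<in> V" "measure \<mu> V < s"
    using half_dist_lessE[of X \<mu> y z s] \<open>y \<noteq> z\<close> le1 \<open>0 < t\<close> unfolding s_def by auto
  have sum: "measure \<mu> (U \<union> V) < r + s"
    using measure_Un_le[OF half_in_sets[OF \<mu> U(1)] half_in_sets[OF \<mu> V(1)]] U(4) V(4) by simp
  have "u = v \<or> U \<subseteq> V \<or> V \<subseteq> U \<or> U \<union> V = topspace X"
    using half_subset_half[OF conn U(1) V(1)] half_subset_half[OF conn V(1) U(1)]
      half_disjoint_half[OF conn U(1) V(1)] half_cover_half[OF conn U(1) V(1)] U(3) V(2) by blast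
  then show False
  proof (elim disjE)
    assume "u = v"
    then have "half_dist X \<mu> x z \<le> measure \<mu> (U \<union> V)"
      using half_Un[of X u U V] U V by (intro half_dist_le) auto
    then show False using sum rs by simp
  next
    assume "U \<subseteq> V"
    then have "half_dist X \<mu> x z \<le> measure \<mu> V" using U V by (intro half_dist_le) auto
    then show False using rs pos V by simp
  next
    assume "V \<subseteq> U"
    then have "half_dist X \<mu> x z \<le> measure \<mu> U" using U V by (intro half_dist_le) auto
    then show False using rs pos U by simp
  next
    assume "U \<union> V = topspace X"
    then have "measure \<mu> (U \<union> V) = 1" using prob_space space_borel_prob[OF \<mu>] by simp
    then show False using sum rs half_dist_le_1[of X \<mu> x z] by simp
  qed
qed

text \<open>Distinct points have positive distance by \<open>half_measure_separation\<close>. For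
  the topology, \<open>small\<close> puts a half inside every ball, so the identity from the
  subspace to the metric space is continuous; as a bijection from a compact to a Hausdorff space it
  is a homeomorphism.\<close>

lemma half_dist_metric:
  assumes X: "dendron X" and \<mu>: "borel_prob X \<mu>" and S: "closedin X S"
    and supp: "\<And>U. openin X U \<Longrightarrow> U \<inter> S \<noteq> {} \<Longrightarrow> 0 < measure \<mu> U"
    and small: "\<And>x e. x \<in> S \<Longrightarrow> 0 < e \<Longrightarrow> \<exists>w U. half X w U \<and> x \<in> U \<and> measure \<mu> U < e"
  shows "Metric_space S (half_dist X \<mu>)"
    and "Metric_space.mtopology S (half_dist X \<mu>) = subtopology X S"
proof -
  have conn: "connected_space X" and comp: "compact_space X"
    using X unfolding dendron_def by auto
  have SX: "S \<subseteq> topspace X" using closedin_subset[OF S] .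
  show "Metric_space S (half_dist X \<mu>)"
  proof
    fix x y assume xy: "x \<in> S" "y \<in> S"
    show "half_dist X \<mu> x y = 0 \<longleftrightarrow> x = y"
    proof
      assume 0: "half_dist X \<mu> x y = 0"
      show "x = y"
      proof (rule ccontr)
        assume "x \<noteq> y"
        obtain \<delta> B where \<delta>: "0 < \<delta>" "openin X B" "y \<in> B"
          "\<And>w U. half X w U \<Longrightarrow> x \<in> U \<Longrightarrow> U \<inter> B \<noteq> {} \<Longrightarrow> \<delta> \<le> measure \<mu> U"
          using half_measure_separation[OF X \<mu> supp xy \<open>x \<noteq> y\<close> SX] by metis
        \<comment> \<open>The minimum with 1 accounts for the default value in the infimum.\<close>
        have "min \<delta> 1 \<le> half_dist X \<mu> x y"
        proof (rule half_dist_greatest[OF \<open>x \<noteq> y\<close>])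
          fix w U assume "half X w U" "x \<in> U" "y \<in> U"
          then have "\<delta> \<le> measure \<mu> U" using \<delta>(3) by (intro \<delta>(4)) auto
          then show "min \<delta> 1 \<le> measure \<mu> U" by simp
        qed simp
        then show False using 0 \<delta>(1) by simp
      qed
    qed (simp add: half_dist_def)
  qed (use half_dist_nonneg half_dist_sym half_dist_triangle[OF conn \<mu>] in auto)
  then interpret Metric_space S "half_dist X \<mu>" .
  have open_sub: "openin (subtopology X S) V" if V: "openin mtopology V" for V
  proof (subst openin_subopen, intro ballI)
    fix x assume "x \<in> V"
    then obtain r where r: "0 < r" "mball x r \<subseteq> V" and "x \<in> S"
      using V unfolding openin_mtopology by blast
    obtain w U where U: "half X w U" "x \<in> U" "measure \<mu> U < r"
      using small[OF \<open>x \<in> S\<close> r(1)] by blast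
    have "U \<inter> S \<subseteq> mball x r"
    proof
      fix v assume v: "v \<in> U \<inter> S"
      then have "half_dist X \<mu> x v \<le> measure \<mu> U" using half_dist_le[OF U(1,2)] by simp
      then show "v \<in> mball x r" using v U(3) \<open>x \<in> S\<close> by simp
    qed
    moreover have "openin (subtopology X S) (U \<inter> S)"
      using U(1) unfolding half_def by (auto simp: openin_subtopology)
    ultimately show "\<exists>T. openin (subtopology X S) T \<and> x \<in> T \<and> T \<subseteq> V"
      using r(2) U(2) \<open>x \<in> S\<close> by (intro exI[of _ "U \<inter> S"]) auto
  qed
  have "continuous_map (subtopology X S) mtopology id"
    unfolding continuous_map_def
  proof (intro conjI allI impI)
    fix V assume V: "openin mtopology V"
    then have "{x \<in> topspace (subtopology X S). id x \<in> V} = V"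
      using openin_subset[OF V] SX by auto
    then show "openin (subtopology X S) {x \<in> topspace (subtopology X S). id x \<in> V}"
      using open_sub[OF V] by simp
  qed (use SX in auto)
  moreover have "compact_space (subtopology X S)"
    using closedin_compact_space[OF comp S] compact_space_subtopology by blast
  ultimately have "homeomorphic_map (subtopology X S) mtopology id"
    using SX by (intro continuous_imp_homeomorphic_map Hausdorff_space_mtopology) auto
  then show "mtopology = subtopology X S" by simp
qed

lemma measure_homeomorphic_image:
  assumes f: "homeomorphic_map X X f" and \<mu>: "borel_prob X \<mu>" "distr \<mu> (borel_of X) f = \<mu>"
    and U: "openin X U"
  shows "measure \<mu> (f ` U) = measure \<mu> U"
proof -
  have UX: "U \<subseteq> topspace X" using openin_subset[OF U] .
  have "openin X (f ` U)" using homeomorphic_map_openness[OF f UX] U by simp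
  moreover have "f \<in> measurable \<mu> (borel_of X)"
    using continuous_map_measurable[OF homeomorphic_imp_continuous_map[OF f]]
      measurable_cong_sets[OF sets_borel_prob[OF \<mu>(1)] refl] by blast
  ultimately have "measure (distr \<mu> (borel_of X) f) (f ` U) = measure \<mu> (f -` (f ` U) \<inter> space \<mu>)"
    by (intro measure_distr) (auto intro: openin_in_sets_borel_of)
  moreover have "f -` (f ` U) \<inter> space \<mu> = U"
    using UX homeomorphic_imp_injective_map[OF f] space_borel_prob[OF \<mu>(1)] by (auto simp: inj_on_def)
  ultimately show ?thesis using \<mu>(2) by simp
qed

text \<open>The map carries halves to halves of the same measure. For a group element, equality
  follows by applying this to its inverse as well.\<close>

lemma half_dist_homeomorphic_le:
  assumes f: "homeomorphic_map X X f" and \<mu>: "borel_prob X \<mu>" "distr \<mu> (borel_of X) f = \<mu>"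
  shows "half_dist X \<mu> (f x) (f y) \<le> half_dist X \<mu> x y"
proof (cases "x = y")
  case False
  show ?thesis
  proof (rule half_dist_greatest[OF False half_dist_le_1])
    fix w U assume U: "half X w U" "x \<in> U" "y \<in> U"
    then have "half_dist X \<mu> (f x) (f y) \<le> measure \<mu> (f ` U)"
      by (intro half_dist_le[OF half_homeomorphic_image[OF f]]) auto
    then show "half_dist X \<mu> (f x) (f y) \<le> measure \<mu> U"
      using measure_homeomorphic_image[OF f \<mu>] U(1) unfolding half_def by simp
  qed
qed (simp add: half_dist_def)


section \<open>Compact group actions\<close>

text \<open>Bijectivity comes from inverses in \<open>G\<close>, and extensionality turns the
  pointwise law into an equality of maps in \<open>BijGroup E\<close>.\<close>

lemma group_actionI:
  assumes G: "group G"
    and closed: "\<And>g x. g \<in> carrier G \<Longrightarrow> x \<in> E \<Longrightarrow> \<phi> g x \<in> E"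
    and ext: "\<And>g. g \<in> carrier G \<Longrightarrow> \<phi> g \<in> extensional E"
    and one: "\<And>x. x \<in> E \<Longrightarrow> \<phi> \<one>\<^bsub>G\<^esub> x = x"
    and mult: "\<And>g h x. g \<in> carrier G \<Longrightarrow> h \<in> carrier G \<Longrightarrow> x \<in> E \<Longrightarrow> \<phi> (g \<otimes>\<^bsub>G\<^esub> h) x = \<phi> g (\<phi> h x)"
  shows "group_action G E \<phi>"
proof -
  interpret group G by (rule G)
  have "bij_betw (\<phi> g) E E" if g: "g \<in> carrier G" for g
  proof (rule bij_betwI)
    show "\<phi> (inv\<^bsub>G\<^esub> g) (\<phi> g x) = x" "\<phi> g (\<phi> (inv\<^bsub>G\<^esub> g) x) = x" if "x \<in> E" for x
      using mult[of "inv\<^bsub>G\<^esub> g" g x] mult[of g "inv\<^bsub>G\<^esub> g" x] one[OF that] g that by simp_all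
  qed (use closed g in auto)
  then have Bij: "\<phi> g \<in> Bij E" if "g \<in> carrier G" for g
    using ext that by (simp add: Bij_def)
  have "\<phi> (g \<otimes>\<^bsub>G\<^esub> h) = \<phi> g \<otimes>\<^bsub>BijGroup E\<^esub> \<phi> h" if "g \<in> carrier G" "h \<in> carrier G" for g h
  proof
    fix x show "\<phi> (g \<otimes>\<^bsub>G\<^esub> h) x = (\<phi> g \<otimes>\<^bsub>BijGroup E\<^esub> \<phi> h) x"
      using that Bij mult ext[of "g \<otimes>\<^bsub>G\<^esub> h"]
      by (cases "x \<in> E") (auto simp: BijGroup_def compose_def extensional_def)
  qed
  then have "\<phi> \<in> hom G (BijGroup E)"
    using Bij by (auto simp: hom_def BijGroup_def)
  then show ?thesis
    by (simp add: group_action_def group_hom_def group_hom_axioms_def G group_BijGroup)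
qed

locale compact_G_space =
  fixes G :: "('g, 'm) monoid_scheme" and TG :: "'g topology" and X :: "'x topology"
    and \<phi> :: "'g \<Rightarrow> 'x \<Rightarrow> 'x"
  assumes topological_group: "topological_group G TG" and system: "compact_system G TG X \<phi>"
begin

sublocale action: group_action G "topspace X" \<phi>
  using system unfolding compact_system_def by blast

lemma compact: "compact_space X" and Hausdorff: "Hausdorff_space X"
  and joint: "continuous_map (prod_topology TG X) X (\<lambda>(g, x). \<phi> g x)"
  using system unfolding compact_system_def by auto

lemma group: "group G" and topspace_TG: "topspace TG = carrier G"
  using topological_group unfolding topological_group_def by auto

sublocale G: group G by (rule group)

lemma act_in: "g \<in> carrier G \<Longrightarrow> x \<in> topspace X \<Longrightarrow> \<phi> g x \<in> topspace X"
  using action.element_image by blast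

lemma act_one: "x \<in> topspace X \<Longrightarrow> \<phi> \<one>\<^bsub>G\<^esub> x = x"
  using action.id_eq_one by (metis restrict_apply')

lemma act_inv:
  assumes "g \<in> carrier G" "x \<in> topspace X"
  shows "\<phi> (inv\<^bsub>G\<^esub> g) (\<phi> g x) = x" "\<phi> g (\<phi> (inv\<^bsub>G\<^esub> g) x) = x"
  using assms action.composition_rule[of x "inv\<^bsub>G\<^esub> g" g] action.composition_rule[of x g "inv\<^bsub>G\<^esub> g"]
  by (simp_all add: act_one)

lemma act_extensional: "g \<in> carrier G \<Longrightarrow> \<phi> g \<in> extensional (topspace X)"
  using action.bij_prop0 by (auto simp: Bij_def)

lemma act_continuous:
  assumes "g \<in> carrier G"
  shows "continuous_map X X (\<phi> g)"
proof -
  have "continuous_map X (prod_topology TG X) (\<lambda>x. (g, x))"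
    using assms by (simp add: continuous_map_pairwise o_def topspace_TG)
  from continuous_map_compose[OF this joint] show ?thesis by (simp add: o_def)
qed

lemma act_homeomorphic:
  assumes "g \<in> carrier G"
  shows "homeomorphic_map X X (\<phi> g)"
  unfolding homeomorphic_map_maps homeomorphic_maps_def
  using assms act_continuous act_inv by (intro exI[of _ "\<phi> (inv\<^bsub>G\<^esub> g)"]) auto

lemma act_image:
  assumes "g \<in> carrier G" "A \<subseteq> topspace X"
  shows "\<phi> g ` A = \<phi> (inv\<^bsub>G\<^esub> g) -` A \<inter> topspace X"
proof
  show "\<phi> g ` A \<subseteq> \<phi> (inv\<^bsub>G\<^esub> g) -` A \<inter> topspace X"
    using assms act_in act_inv(1) by auto
  show "\<phi> (inv\<^bsub>G\<^esub> g) -` A \<inter> topspace X \<subseteq> \<phi> g ` A"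
    using assms act_inv(2) by (metis IntE image_eqI subsetI vimageE)
qed

lemma compact_system_restrict:
  assumes M: "closedin X M" "invariant_set G \<phi> M"
  shows "compact_system G TG (subtopology X M) (restrict_action \<phi> M)"
  unfolding compact_system_def
proof (intro conjI)
  have MX: "M \<subseteq> topspace X" using closedin_subset[OF M(1)] .
  then have top: "topspace (subtopology X M) = M" by auto
  have inv: "\<phi> g x \<in> M" if "g \<in> carrier G" "x \<in> M" for g x
    using M(2) that unfolding invariant_set_def by blast
  show "compact_space (subtopology X M)"
    using closedin_compact_space[OF compact M(1)] compact_space_subtopology by blast
  show "Hausdorff_space (subtopology X M)" using Hausdorff by (rule Hausdorff_space_subtopology)
  show "group_action G (topspace (subtopology X M)) (restrict_action \<phi> M)"
    unfolding top restrict_action_def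
    using inv MX by (intro group_actionI group) (auto simp: act_one action.composition_rule subset_iff)
  have "continuous_map (subtopology (prod_topology TG X) (topspace TG \<times> M)) (subtopology X M) (\<lambda>(g, x). \<phi> g x)"
    using inv joint MX by (auto simp: continuous_map_in_subtopology topspace_TG intro!: continuous_map_from_subtopology)
  then have "continuous_map (prod_topology TG (subtopology X M)) (subtopology X M) (\<lambda>(g, x). \<phi> g x)"
    by (simp add: prod_topology_subtopology(2)[symmetric] subtopology_Times)
  then show "continuous_map (prod_topology TG (subtopology X M)) (subtopology X M)
      (\<lambda>(g, x). restrict_action \<phi> M g x)"
    by (rule continuous_map_eq) (auto simp: restrict_action_def)
qed

text \<open>Conjugation moves a system to another type: once to the functionals over which
  amenability quantifies, once to the singletons that carry the equicontinuous factor.\<close>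

lemma compact_system_transport:
  assumes e: "homeomorphic_maps X Y e e'"
  shows "compact_system G TG Y (\<lambda>g. \<lambda>y\<in>topspace Y. e (\<phi> g (e' y)))"
  unfolding compact_system_def
proof (intro conjI)
  have e_in: "e x \<in> topspace Y" if "x \<in> topspace X" for x
    using e that unfolding homeomorphic_maps_def continuous_map_def by blast
  have e'_in: "e' y \<in> topspace X" if "y \<in> topspace Y" for y
    using e that unfolding homeomorphic_maps_def continuous_map_def by blast
  have e'e: "e' (e x) = x" if "x \<in> topspace X" for x
    using e that unfolding homeomorphic_maps_def by blast
  have ee': "e (e' y) = y" if "y \<in> topspace Y" for y
    using e that unfolding homeomorphic_maps_def by blast
  have "X homeomorphic_space Y" using e unfolding homeomorphic_space_def by blast
  then show "compact_space Y" "Hausdorff_space Y"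
    using compact Hausdorff homeomorphic_compact_space homeomorphic_Hausdorff_space by blast+
  show "group_action G (topspace Y) (\<lambda>g. \<lambda>y\<in>topspace Y. e (\<phi> g (e' y)))"
    using e_in e'_in e'e ee' act_in by (intro group_actionI group) (auto simp: act_one action.composition_rule)
  have "continuous_map (prod_topology TG Y) (prod_topology TG X) (\<lambda>p. (fst p, e' (snd p)))"
    using e unfolding homeomorphic_maps_def
    by (intro continuous_map_pairedI continuous_map_fst continuous_map_compose[OF continuous_map_snd, unfolded o_def]) auto
  from continuous_map_compose[OF this joint]
  have "continuous_map (prod_topology TG Y) X (\<lambda>p. \<phi> (fst p) (e' (snd p)))" by (simp add: o_def)
  moreover have "continuous_map X Y e" using e unfolding homeomorphic_maps_def by blast
  ultimately have "continuous_map (prod_topology TG Y) Y (\<lambda>p. e (\<phi> (fst p) (e' (snd p))))"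
    by (rule continuous_map_compose[unfolded o_def])
  then show "continuous_map (prod_topology TG Y) Y (\<lambda>(g, y). (\<lambda>y\<in>topspace Y. e (\<phi> g (e' y))) y)"
    by (rule continuous_map_eq) auto
qed

lemma minimal_subset_subtopology:
  assumes "minimal_subset G X \<phi> M"
  shows "minimal_subset G (subtopology X M) (restrict_action \<phi> M) (topspace (subtopology X M))"
proof -
  have M: "M \<noteq> {}" "closedin X M" "invariant_set G \<phi> M"
    and least: "\<And>N. N \<noteq> {} \<Longrightarrow> closedin X N \<Longrightarrow> invariant_set G \<phi> N \<Longrightarrow> N \<subseteq> M \<Longrightarrow> N = M"
    using assms unfolding minimal_subset_def by auto
  have top: "topspace (subtopology X M) = M" using closedin_subset[OF M(2)] by auto
  have inv: "invariant_set G (restrict_action \<phi> M) N \<longleftrightarrow> invariant_set G \<phi> N" if "N \<subseteq> M" for N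
    using that unfolding invariant_set_def restrict_action_def by (auto simp: image_subset_iff subset_iff)
  show ?thesis
    unfolding minimal_subset_def top
  proof (intro conjI allI impI)
    fix N assume N: "N \<noteq> {} \<and> closedin (subtopology X M) N \<and> invariant_set G (restrict_action \<phi> M) N \<and> N \<subseteq> M"
    then have "closedin X N" using M(2) closedin_closed_subtopology by blast
    then show "N = M" using N inv[of N] by (intro least) auto
  qed (use M inv[of M] top in \<open>auto simp: closedin_subtopology_refl\<close>)
qed

lemma minimal_subset_transport:
  assumes e: "homeomorphic_maps X Y e e'" and min: "minimal_subset G X \<phi> (topspace X)"
  shows "minimal_subset G Y (\<lambda>g. \<lambda>y\<in>topspace Y. e (\<phi> g (e' y))) (topspace Y)"
proof -
  have e'_in: "e' y \<in> topspace X" if "y \<in> topspace Y" for y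
    using e that unfolding homeomorphic_maps_def continuous_map_def by blast
  have e_in: "e x \<in> topspace Y" if "x \<in> topspace X" for x
    using e that unfolding homeomorphic_maps_def continuous_map_def by blast
  have ee': "e (e' y) = y" if "y \<in> topspace Y" for y
    using e that unfolding homeomorphic_maps_def by blast
  have e'e: "e' (e x) = x" if "x \<in> topspace X" for x
    using e that unfolding homeomorphic_maps_def by blast
  show ?thesis
    unfolding minimal_subset_def
  proof (intro conjI allI impI)
    show "topspace Y \<noteq> {}"
      using min e_in unfolding minimal_subset_def by blast
    show "invariant_set G (\<lambda>g. \<lambda>y\<in>topspace Y. e (\<phi> g (e' y))) (topspace Y)"
      using e_in e'_in act_in unfolding invariant_set_def by auto
    fix N assume N: "N \<noteq> {} \<and> closedin Y N \<and>
      invariant_set G (\<lambda>g. \<lambda>y\<in>topspace Y. e (\<phi> g (e' y))) N \<and> N \<subseteq> topspace Y"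
    have "homeomorphic_map Y X e'" using e homeomorphic_maps_sym homeomorphic_map_maps by blast
    then have "closedin X (e' ` N)" using N homeomorphic_map_closedness by blast
    moreover have "invariant_set G \<phi> (e' ` N)"
      unfolding invariant_set_def
    proof (intro ballI subsetI)
      fix g z assume g: "g \<in> carrier G" and "z \<in> \<phi> g ` e' ` N"
      then obtain y where y: "y \<in> N" "z = \<phi> g (e' y)" by auto
      then have "y \<in> topspace Y" using N by auto
      then have "e z \<in> N" using N g y unfolding invariant_set_def by (fastforce simp: image_subset_iff)
      moreover have "z = e' (e z)" using e'e act_in[OF g e'_in] y(2) \<open>y \<in> topspace Y\<close> by simp
      ultimately show "z \<in> e' ` N" by blast
    qed
    moreover have "e' ` N \<noteq> {}" "e' ` N \<subseteq> topspace X" using N e'_in by auto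
    ultimately have "e' ` N = topspace X" using min unfolding minimal_subset_def by auto
    then have "y \<in> N" if "y \<in> topspace Y" for y
      using e'_in[OF that] ee' N that by (metis (no_types, lifting) image_iff subsetD)
    then show "N = topspace Y" using N by auto
  qed auto
qed

text \<open>The points of \<open>M\<close> whose whole orbit avoids \<open>U\<close> form a closed
  invariant set. If it contained \<open>y\<close> it would be all of \<open>M\<close>, but a point
  of \<open>U\<close> in \<open>M\<close> is not in it.\<close>

lemma minimal_orbit_meets:
  assumes M: "minimal_subset G X \<phi> M" and y: "y \<in> M" and U: "openin X U" "U \<inter> M \<noteq> {}"
  shows "\<exists>g\<in>carrier G. \<phi> g y \<in> U"
proof (rule ccontr)
  assume notin: "\<not> ?thesis"
  have MX: "M \<subseteq> topspace X" and inv: "invariant_set G \<phi> M" and "closedin X M"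
    using M closedin_subset unfolding minimal_subset_def by auto
  define N where "N = M \<inter> (\<Inter>g\<in>carrier G. {x \<in> topspace X. \<phi> g x \<in> topspace X - U})"
  have "closedin X N"
    unfolding N_def using \<open>closedin X M\<close> U(1) act_continuous
    by (intro closedin_Int closedin_INT closedin_continuous_map_preimage) auto
  moreover have "y \<in> N"
    unfolding N_def using y MX act_in notin by auto
  moreover have "invariant_set G \<phi> N"
    unfolding invariant_set_def
  proof (intro ballI subsetI)
    fix g z assume g: "g \<in> carrier G" and "z \<in> \<phi> g ` N"
    then obtain x where x: "x \<in> N" "z = \<phi> g x" by auto
    then have "x \<in> M" "x \<in> topspace X" using MX unfolding N_def by auto
    moreover have "\<phi> h z \<in> topspace X - U" if h: "h \<in> carrier G" for h
    proof -
      have "\<phi> h z = \<phi> (h \<otimes>\<^bsub>G\<^esub> g) x" using action.composition_rule[of x h g] \<open>x \<in> topspace X\<close> h g x by simp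
      then show ?thesis using x(1) h g unfolding N_def by auto
    qed
    ultimately show "z \<in> N"
      using inv g x(2) act_in unfolding N_def invariant_set_def by auto
  qed
  ultimately have "N = M"
    using M unfolding minimal_subset_def by (metis (no_types, lifting) N_def empty_iff inf_le1)
  moreover obtain u where "u \<in> U" "u \<in> M" using U(2) by auto
  ultimately have "\<phi> \<one>\<^bsub>G\<^esub> u \<notin> U" unfolding N_def by auto
  then show False using act_one \<open>u \<in> U\<close> \<open>u \<in> M\<close> MX by auto
qed

section \<open>Invariant measures on a compact system\<close>

lemma act_measurable:
  assumes "borel_prob X \<mu>" "g \<in> carrier G"
  shows "\<phi> g \<in> measurable \<mu> (borel_of X)"
  using continuous_map_measurable[OF act_continuous[OF assms(2)]]
    measurable_cong_sets[OF sets_borel_prob[OF assms(1)] refl] by blast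

lemma
  assumes \<mu>: "invariant_prob G X \<phi> \<mu>" and g: "g \<in> carrier G" and A: "A \<in> sets \<mu>"
  shows act_image_sets: "\<phi> g ` A \<in> sets \<mu>"
    and act_image_measure: "measure \<mu> (\<phi> g ` A) = measure \<mu> A"
proof -
  have prob: "borel_prob X \<mu>" and inv: "distr \<mu> (borel_of X) (\<phi> (inv\<^bsub>G\<^esub> g)) = \<mu>"
    using \<mu> g unfolding invariant_prob_def by auto
  have AX: "A \<subseteq> topspace X" using sets.sets_into_space[OF A] space_borel_prob[OF prob] by simp
  have meas: "\<phi> (inv\<^bsub>G\<^esub> g) \<in> measurable \<mu> (borel_of X)" using act_measurable[OF prob] g by simp
  have image: "\<phi> g ` A = \<phi> (inv\<^bsub>G\<^esub> g) -` A \<inter> space \<mu>"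
    using act_image[OF g AX] space_borel_prob[OF prob] by simp
  have A': "A \<in> sets (borel_of X)" using A sets_borel_prob[OF prob] by simp
  show "\<phi> g ` A \<in> sets \<mu>" unfolding image by (rule measurable_sets[OF meas A'])
  show "measure \<mu> (\<phi> g ` A) = measure \<mu> A"
    using measure_distr[OF meas A'] inv image by simp
qed

lemma act_half:
  assumes "g \<in> carrier G" "half X w U"
  shows "half X (\<phi> g w) (\<phi> g ` U)"
  by (rule half_homeomorphic_image[OF act_homeomorphic[OF assms(1)] assms(2)])

lemma act_image_openin:
  assumes "g \<in> carrier G" "openin X U"
  shows "openin X (\<phi> g ` U)"
  using homeomorphic_map_openness[OF act_homeomorphic[OF assms(1)] openin_subset[OF assms(2)]] assms(2) by simp

text \<open>Translates of \<open>U\<close> cover \<open>M\<close>, finitely many suffice by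
  compactness, and all have the measure of \<open>U\<close>; a null \<open>U\<close> would make
  \<open>M\<close> null.\<close>

lemma minimal_open_measure_pos:
  assumes M: "minimal_subset G X \<phi> M" and \<mu>: "invariant_prob G X \<phi> \<mu>" "measure \<mu> M = 1"
    and U: "openin X U" "U \<inter> M \<noteq> {}"
  shows "0 < measure \<mu> U"
proof (rule ccontr)
  assume "\<not> 0 < measure \<mu> U"
  then have null: "measure \<mu> U = 0" by (simp add: zero_less_measure_iff)
  have prob: "borel_prob X \<mu>" using \<mu>(1) unfolding invariant_prob_def by simp
  interpret prob_space \<mu> by (rule borel_prob_prob_space[OF prob])
  have "closedin X M" using M unfolding minimal_subset_def by simp
  then have "compactin X M" using compact closedin_compact_space by blast
  have U': "U \<in> sets \<mu>" using openin_in_sets_borel_prob[OF prob U(1)] .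
  have "M \<subseteq> \<Union>((\<lambda>g. \<phi> g ` U) ` carrier G)"
  proof
    fix y assume y: "y \<in> M"
    then obtain g where g: "g \<in> carrier G" "\<phi> g y \<in> U" using minimal_orbit_meets[OF M _ U] by blast
    moreover have "y \<in> topspace X" using y closedin_subset[OF \<open>closedin X M\<close>] by auto
    ultimately have "y = \<phi> (inv\<^bsub>G\<^esub> g) (\<phi> g y)" using act_inv by simp
    then show "y \<in> \<Union>((\<lambda>g. \<phi> g ` U) ` carrier G)" using g by (intro UN_I[of "inv\<^bsub>G\<^esub> g"]) auto
  qed
  moreover have "\<forall>V\<in>(\<lambda>g. \<phi> g ` U) ` carrier G. openin X V" using act_image_openin U(1) by auto
  ultimately obtain \<F> where \<F>: "finite \<F>" "\<F> \<subseteq> (\<lambda>g. \<phi> g ` U) ` carrier G" "M \<subseteq> \<Union>\<F>"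
    using \<open>compactin X M\<close> unfolding compactin_def by meson
  have "measure \<mu> V = 0 \<and> V \<in> sets \<mu>" if "V \<in> \<F>" for V
    using that \<F>(2) act_image_measure[OF \<mu>(1) _ U'] act_image_sets[OF \<mu>(1) _ U'] null by auto
  then have "\<Union>\<F> \<in> null_sets \<mu>"
    using \<F>(1) by (intro null_sets.finite_Union) (auto simp: null_sets_def emeasure_eq_measure)
  then have "measure \<mu> (\<Union>\<F>) = 0" "\<Union>\<F> \<in> sets \<mu>" by (auto simp: null_sets_def measure_def)
  then show False
    using finite_measure_mono[OF \<F>(3)] \<mu>(2) by simp
qed

text \<open>All points of the orbit carry the same mass, so there are at most
  \<open>1 / measure \<mu> {x}\<close> of them.\<close>

lemma finite_orbit_of_atom:
  assumes \<mu>: "invariant_prob G X \<phi> \<mu>" and x: "x \<in> topspace X" "0 < measure \<mu> {x}"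
  shows "finite (orbit G \<phi> x)"
proof (rule ccontr)
  assume inf: "infinite (orbit G \<phi> x)"
  have prob: "borel_prob X \<mu>" using \<mu> unfolding invariant_prob_def by simp
  interpret prob_space \<mu> by (rule borel_prob_prob_space[OF prob])
  have "closedin X {x}" using Hausdorff x(1) by (simp add: closedin_Hausdorff_sing_eq)
  then have x': "{x} \<in> sets \<mu>" by (rule closedin_in_sets_borel_prob[OF prob])
  obtain n :: nat where n: "1 / measure \<mu> {x} < n" using reals_Archimedean2 by blast
  obtain F where F: "F \<subseteq> orbit G \<phi> x" "finite F" "card F = n"
    using infinite_arbitrarily_large[OF inf] by blast
  have pt: "{y} \<in> sets \<mu> \<and> measure \<mu> {y} = measure \<mu> {x}" if "y \<in> F" for y
    using that F(1) act_image_sets[OF \<mu> _ x'] act_image_measure[OF \<mu> _ x'] unfolding orbit_def by auto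
  then have "measure \<mu> F = (\<Sum>y\<in>F. measure \<mu> {y})"
    using F(2) by (intro finite_measure_eq_sum_singleton) auto
  also have "\<dots> = n * measure \<mu> {x}" using pt F(3) by simp
  finally have "n * measure \<mu> {x} \<le> 1" using prob_le_1[of F] by simp
  then show False using n x(2) by (simp add: field_simps)
qed

lemma orbit_subset: "x \<in> topspace X \<Longrightarrow> orbit G \<phi> x \<subseteq> topspace X"
  unfolding orbit_def using act_in by auto

lemma invariant_orbit:
  assumes "x \<in> topspace X"
  shows "invariant_set G \<phi> (orbit G \<phi> x)"
  unfolding invariant_set_def
proof (intro ballI subsetI)
  fix g z assume g: "g \<in> carrier G" and "z \<in> \<phi> g ` orbit G \<phi> x"
  then obtain h where h: "h \<in> carrier G" "z = \<phi> g (\<phi> h x)" unfolding orbit_def by auto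
  then have "z = \<phi> (g \<otimes>\<^bsub>G\<^esub> h) x" using action.composition_rule[OF assms g h(1)] by simp
  then show "z \<in> orbit G \<phi> x" unfolding orbit_def using g h(1) by blast
qed

text \<open>The orbit of an atom in \<open>M\<close> is finite, hence a closed invariant subset,
  hence all of \<open>M\<close>.\<close>

lemma minimal_atomless:
  assumes M: "minimal_subset G X \<phi> M" "infinite M" and \<mu>: "invariant_prob G X \<phi> \<mu>" and x: "x \<in> M"
  shows "measure \<mu> {x} = 0"
proof (rule ccontr)
  assume "measure \<mu> {x} \<noteq> 0"
  then have "0 < measure \<mu> {x}" by (simp add: zero_less_measure_iff)
  have MX: "M \<subseteq> topspace X" and inv: "invariant_set G \<phi> M"
    using M closedin_subset unfolding minimal_subset_def by auto
  then have xX: "x \<in> topspace X" using x by auto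
  then have fin: "finite (orbit G \<phi> x)" using finite_orbit_of_atom[OF \<mu>] \<open>0 < measure \<mu> {x}\<close> by simp
  then have "closedin X (orbit G \<phi> x)"
    using Hausdorff orbit_subset[OF xX] by (simp add: closedin_Hausdorff_finite)
  moreover have "orbit G \<phi> x \<subseteq> M" using inv x unfolding orbit_def invariant_set_def by auto
  moreover have "orbit G \<phi> x \<noteq> {}" using action.orbit_refl[OF xX] by auto
  ultimately have "orbit G \<phi> x = M"
    using M(1) invariant_orbit[OF xX] unfolding minimal_subset_def by blast
  then show False using fin M(2) by simp
qed

theorem minimal_invariant_metric:
  assumes X: "dendrite X" and M: "minimal_subset G X \<phi> M"
    and \<mu>: "invariant_prob G X \<phi> \<mu>" "measure \<mu> M = 1"
  obtains d where "Metric_space M d" "Metric_space.mtopology M d = subtopology X M"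
    "\<And>g x y. g \<in> carrier G \<Longrightarrow> x \<in> M \<Longrightarrow> y \<in> M \<Longrightarrow> d (\<phi> g x) (\<phi> g y) = d x y"
proof -
  have closed: "closedin X M" and inv: "invariant_set G \<phi> M" and MX: "M \<subseteq> topspace X"
    using M closedin_subset unfolding minimal_subset_def by auto
  have prob: "borel_prob X \<mu>" and dist: "\<And>g. g \<in> carrier G \<Longrightarrow> distr \<mu> (borel_of X) (\<phi> g) = \<mu>"
    using \<mu>(1) unfolding invariant_prob_def by auto
  note supp = minimal_open_measure_pos[OF M \<mu>]
  show thesis
  proof (cases "finite M")
    case True
    interpret discrete_metric M .
    have "t1_space X" using Hausdorff by (rule Hausdorff_imp_t1_space)
    then have "subtopology X M = discrete_topology M"
      using True MX by (simp add: subtopology_eq_discrete_topology_gen_finite Int_absorb1)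
    moreover have "dd (\<phi> g x) (\<phi> g y) = dd x y" if "g \<in> carrier G" "x \<in> M" "y \<in> M" for g x y
      using that MX action.inj_prop[OF that(1)] unfolding dd_def by (auto dest: inj_onD)
    ultimately show thesis
      using that[of dd] mtopology_discrete_metric disc.Metric_space_axioms by simp
  next
    case False
    \<comment> \<open>\<open>dendrite_small_half\<close> only finds a small half somewhere along
      \<open>M\<close>. Minimality moves \<open>x\<close> into it, and moving the half back keeps
      its measure.\<close>
    have small: "\<exists>w U. half X w U \<and> x \<in> U \<and> measure \<mu> U < e" if x: "x \<in> M" and e: "0 < e" for x e
    proof -
      obtain w U where U: "half X w U" "U \<inter> M \<noteq> {}" "measure \<mu> U < e"
        using dendrite_small_half[OF X prob closed \<mu>(2) supp minimal_atomless[OF M False \<mu>(1)] e] by blast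
      have "openin X U" using U(1) unfolding half_def by simp
      then obtain g where g: "g \<in> carrier G" "\<phi> g x \<in> U" using minimal_orbit_meets[OF M x _ U(2)] by blast
      have "x = \<phi> (inv\<^bsub>G\<^esub> g) (\<phi> g x)" using act_inv[OF g(1)] x MX by auto
      then have "x \<in> \<phi> (inv\<^bsub>G\<^esub> g) ` U" using g(2) by blast
      moreover have "half X (\<phi> (inv\<^bsub>G\<^esub> g) w) (\<phi> (inv\<^bsub>G\<^esub> g) ` U)" using act_half[OF _ U(1)] g(1) by simp
      moreover have "measure \<mu> (\<phi> (inv\<^bsub>G\<^esub> g) ` U) < e"
        using act_image_measure[OF \<mu>(1) _ half_in_sets[OF prob U(1)]] g(1) U(3) by simp
      ultimately show ?thesis by blast
    qed
    have D: "dendron X" using X unfolding dendrite_def by simp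
    have le: "half_dist X \<mu> (\<phi> g x) (\<phi> g y) \<le> half_dist X \<mu> x y" if "g \<in> carrier G" for g x y
      by (rule half_dist_homeomorphic_le[OF act_homeomorphic[OF that] prob dist[OF that]])
    have "half_dist X \<mu> (\<phi> g x) (\<phi> g y) = half_dist X \<mu> x y"
      if g: "g \<in> carrier G" and "x \<in> M" "y \<in> M" for g x y
    proof (rule antisym[OF le[OF g]])
      have "x \<in> topspace X" "y \<in> topspace X" using that MX by auto
      then show "half_dist X \<mu> x y \<le> half_dist X \<mu> (\<phi> g x) (\<phi> g y)"
        using le[of "inv\<^bsub>G\<^esub> g" "\<phi> g x" "\<phi> g y"] act_inv(1)[OF g] g by simp
    qed
    then show thesis
      using that[of "half_dist X \<mu>"] half_dist_metric[OF D prob closed supp small] by blast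
  qed
qed

end


section \<open>Measures uniformly distributed on balls\<close>

lemma borel_prob_eqI:
  assumes \<mu>: "borel_prob X \<mu>" and \<nu>: "borel_prob X \<nu>"
    and eq: "\<And>C. closedin X C \<Longrightarrow> measure \<mu> C = measure \<nu> C"
  shows "\<mu> = \<nu>"
proof -
  interpret \<mu>: prob_space \<mu> by (rule borel_prob_prob_space[OF \<mu>])
  interpret \<nu>: prob_space \<nu> by (rule borel_prob_prob_space[OF \<nu>])
  have eqU: "measure \<mu> U = measure \<nu> U" if U: "openin X U" for U
  proof -
    have "closedin X (topspace X - U)" using U by (intro closedin_diff) auto
    from eq[OF this] show ?thesis
      using \<mu>.prob_compl[OF openin_in_sets_borel_prob[OF \<mu> U]] \<nu>.prob_compl[OF openin_in_sets_borel_prob[OF \<nu> U]]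
        space_borel_prob[OF \<mu>] space_borel_prob[OF \<nu>] by simp
  qed
  show ?thesis
  proof (rule measure_eqI_generator_eq[where E = "{U. openin X U}" and \<Omega> = "topspace X" and A = "\<lambda>_. topspace X"])
    show "Int_stable {U. openin X U}" by (auto simp: Int_stable_def)
    show "{U. openin X U} \<subseteq> Pow (topspace X)" by (auto dest: openin_subset)
    show "emeasure \<mu> U = emeasure \<nu> U" if "U \<in> {U. openin X U}" for U
      using eqU that by (simp add: \<mu>.emeasure_eq_measure \<nu>.emeasure_eq_measure)
    show "sets \<mu> = sigma_sets (topspace X) {U. openin X U}" "sets \<nu> = sigma_sets (topspace X) {U. openin X U}"
      using sets_borel_prob[OF \<mu>] sets_borel_prob[OF \<nu>] sets_borel_of[of X] by auto
  qed auto
qed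

context Metric_space
begin

lemma compact_countable_dense:
  assumes "compact_space mtopology"
  obtains D where "countable D" "D \<subseteq> M" "\<And>x r. x \<in> M \<Longrightarrow> 0 < r \<Longrightarrow> \<exists>s\<in>D. d s x < r"
proof -
  have "mtotally_bounded M"
    using compactin_imp_mtotally_bounded[of M] assms by (simp add: compact_space_def)
  then have "\<exists>K. finite K \<and> K \<subseteq> M \<and> M \<subseteq> (\<Union>x\<in>K. mball x (1 / Suc n))" for n :: nat
    unfolding mtotally_bounded_def by simp
  then obtain K where K: "\<And>n. finite (K n) \<and> K n \<subseteq> M \<and> M \<subseteq> (\<Union>x\<in>K n. mball x (1 / Suc n))"
    by metis
  have "\<exists>s\<in>\<Union>(range K). d s x < r" if x: "x \<in> M" "0 < r" for x r
  proof -
    obtain n :: nat where n: "1 / Suc n < r" using nat_approx_posE[OF x(2)] by blast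
    obtain s where "s \<in> K n" "x \<in> mball s (1 / Suc n)" using K[of n] x(1) by blast
    then show ?thesis using n by force
  qed
  then show thesis
    using that[of "\<Union>(range K)"] K by (simp add: countable_finite UN_least)
qed

text \<open>Fubini's theorem requires membership in the product of the two \<sigma>-algebras, so the
  open relation is written as a countable union of rectangles centred in a dense set.\<close>

lemma less_relation_measurable:
  assumes comp: "compact_space mtopology" and \<mu>: "borel_prob mtopology \<mu>" and \<nu>: "borel_prob mtopology \<nu>"
  shows "{(x, y). x \<in> M \<and> y \<in> M \<and> d x y < r} \<in> sets (\<mu> \<Otimes>\<^sub>M \<nu>)"
proof -
  obtain D where D: "countable D" "D \<subseteq> M" "\<And>x r. x \<in> M \<Longrightarrow> 0 < r \<Longrightarrow> \<exists>s\<in>D. d s x < r"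
    using compact_countable_dense[OF comp] by metis
  have "{(x, y). x \<in> M \<and> y \<in> M \<and> d x y < r} =
    (\<Union>s\<in>D. \<Union>n::nat. mball s (1 / Suc n) \<times> mball s (r - 1 / Suc n))" (is "?L = ?R")
  proof (intro equalityI subsetI)
    fix p assume "p \<in> ?L"
    then obtain x y where p: "p = (x, y)" "x \<in> M" "y \<in> M" "d x y < r" by auto
    \<comment> \<open>The slack is spent twice: once on the way from \<open>s\<close> to
      \<open>x\<close>, once on the reduced radius of the second ball.\<close>
    obtain n :: nat where n: "1 / Suc n < (r - d x y) / 2" using nat_approx_posE[of "(r - d x y) / 2"] p by auto
    obtain s where s: "s \<in> D" "d s x < 1 / Suc n" using D(3)[of x "1 / Suc n"] p by auto
    have "d s y \<le> d s x + d x y" using triangle D(2) s(1) p by auto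
    define \<delta> where "\<delta> = 1 / real (Suc n)"
    have "\<delta> < (r - d x y) / 2" "d s x < \<delta>" using n s(2) unfolding \<delta>_def by simp_all
    then have "2 * \<delta> < r - d x y" by (simp add: field_simps)
    then have "d s y < r - \<delta>" using \<open>d s y \<le> d s x + d x y\<close> \<open>d s x < \<delta>\<close> by linarith
    then have "d s y < r - 1 / Suc n" unfolding \<delta>_def by simp
    then show "p \<in> ?R" using p s D(2) by (intro UN_I[of s] UN_I[of n]) auto
  next
    fix p assume "p \<in> ?R"
    then obtain s n x y where s: "s \<in> D" "p = (x, y)" "x \<in> mball s (1 / Suc n)" "y \<in> mball s (r - 1 / Suc n)" by auto
    then have "d x y \<le> d s x + d s y" using triangle[of x s y] commute[of x s] by auto
    then show "p \<in> ?L" using s by auto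
  qed
  also have "\<dots> \<in> sets (\<mu> \<Otimes>\<^sub>M \<nu>)"
    using D(1) openin_in_sets_borel_prob[OF \<mu>] openin_in_sets_borel_prob[OF \<nu>]
    by (intro sets.countable_UN' sets.countable_UN pair_measureI) auto
  finally show ?thesis .
qed

definition nbhd :: "'a set \<Rightarrow> real \<Rightarrow> 'a set" where
  "nbhd C r = (\<Union>x\<in>C. mball x r)"

lemma openin_nbhd: "openin mtopology (nbhd C r)"
  unfolding nbhd_def by (intro openin_Union) auto

lemma nbhd_Inter:
  assumes "closedin mtopology C"
  shows "(\<Inter>n::nat. nbhd C (1 / Suc n)) = C"
proof (intro equalityI subsetI)
  fix y assume y: "y \<in> (\<Inter>n::nat. nbhd C (1 / Suc n))"
  show "y \<in> C"
  proof (rule ccontr)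
    assume "y \<notin> C"
    moreover have "y \<in> M" using y unfolding nbhd_def by auto
    ultimately obtain r where r: "0 < r" "mball y r \<subseteq> M - C"
      using assms unfolding closedin_def openin_mtopology by auto
    obtain n :: nat where n: "1 / Suc n < r" using nat_approx_posE[OF r(1)] by blast
    obtain x where "x \<in> C" "y \<in> mball x (1 / Suc n)" using y unfolding nbhd_def by blast
    then have "x \<in> mball y r" using n commute by auto
    then show False using r(2) \<open>x \<in> C\<close> by auto
  qed
next
  fix y assume "y \<in> C"
  then show "y \<in> (\<Inter>n::nat. nbhd C (1 / Suc n))"
    using closedin_subset[OF assms] unfolding nbhd_def by (intro INT_I UN_I[of y]) auto
qed

text \<open>Both sides of the conclusion compare with the \<open>\<mu> \<times> \<nu>\<close>-measure of the pairs at distance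
  less than \<open>r\<close> whose first component lies in \<open>C\<close>.\<close>

lemma uniform_on_balls_Fubini:
  assumes comp: "compact_space mtopology" and \<mu>: "borel_prob mtopology \<mu>" and \<nu>: "borel_prob mtopology \<nu>"
    and a: "\<And>x. x \<in> M \<Longrightarrow> measure \<mu> (mball x r) = a" and b: "\<And>x. x \<in> M \<Longrightarrow> measure \<nu> (mball x r) = b"
    and C: "closedin mtopology C"
  shows "b * measure \<mu> C \<le> a * measure \<nu> (nbhd C r)"
proof -
  interpret \<mu>: prob_space \<mu> by (rule borel_prob_prob_space[OF \<mu>])
  interpret \<nu>: prob_space \<nu> by (rule borel_prob_prob_space[OF \<nu>])
  interpret pair_prob_space \<mu> \<nu> ..
  have sp: "space \<mu> = M" "space \<nu> = M" using space_borel_prob[OF \<mu>] space_borel_prob[OF \<nu>] by auto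
  have CM: "C \<subseteq> M" using closedin_subset[OF C] by simp
  have C': "C \<in> sets \<mu>" using closedin_in_sets_borel_prob[OF \<mu> C] .
  have N: "nbhd C r \<in> sets \<nu>" by (rule openin_in_sets_borel_prob[OF \<nu> openin_nbhd])
  have "M \<noteq> {}" using \<mu>.not_empty sp by simp
  then have ab: "0 \<le> a" "0 \<le> b" using a b measure_nonneg by (metis ex_in_conv)+
  define E where "E = {(x, y). x \<in> M \<and> y \<in> M \<and> d x y < r} \<inter> (C \<times> space \<nu>)"
  have E: "E \<in> sets (\<mu> \<Otimes>\<^sub>M \<nu>)"
    unfolding E_def by (rule sets.Int[OF less_relation_measurable[OF comp \<mu> \<nu>] pair_measureI[OF C' sets.top]])
  have "ennreal b * emeasure \<mu> C = (\<integral>\<^sup>+x. ennreal b * indicator C x \<partial>\<mu>)"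
    using C' by (simp add: nn_integral_cmult_indicator)
  also have "\<dots> = (\<integral>\<^sup>+x. emeasure \<nu> (Pair x -` E) \<partial>\<mu>)"
  proof (rule nn_integral_cong)
    fix x assume "x \<in> space \<mu>"
    then have "x \<in> M" using sp by simp
    then have "Pair x -` E = (if x \<in> C then mball x r else {})"
      unfolding E_def by (auto simp: sp)
    moreover note \<open>x \<in> M\<close>
    ultimately show "ennreal b * indicator C x = emeasure \<nu> (Pair x -` E)"
      using b[of x] by (simp add: \<nu>.emeasure_eq_measure)
  qed
  also have "\<dots> = emeasure (\<mu> \<Otimes>\<^sub>M \<nu>) E" using \<nu>.emeasure_pair_measure_alt[OF E] by simp
  also have "\<dots> = (\<integral>\<^sup>+y. emeasure \<mu> ((\<lambda>x. (x, y)) -` E) \<partial>\<nu>)" by (rule emeasure_pair_measure_alt2[OF E])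
  \<comment> \<open>The slice at \<open>y\<close> lies in \<open>mball y r\<close>, of \<mu>-measure
    \<open>a\<close>, and is empty unless some point of \<open>C\<close> is within \<open>r\<close>
    of \<open>y\<close>.\<close>
  also have "\<dots> \<le> (\<integral>\<^sup>+y. ennreal a * indicator (nbhd C r) y \<partial>\<nu>)"
  proof (rule nn_integral_mono)
    fix y assume y: "y \<in> space \<nu>"
    show "emeasure \<mu> ((\<lambda>x. (x, y)) -` E) \<le> ennreal a * indicator (nbhd C r) y"
    proof (cases "y \<in> nbhd C r")
      case True
      have "(\<lambda>x. (x, y)) -` E \<subseteq> mball y r" unfolding E_def using commute by auto
      then have "emeasure \<mu> ((\<lambda>x. (x, y)) -` E) \<le> emeasure \<mu> (mball y r)"
        using openin_in_sets_borel_prob[OF \<mu>] by (intro emeasure_mono) auto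
      then show ?thesis using True a y sp ab by (simp add: \<mu>.emeasure_eq_measure ennreal_leI)
    next
      case False
      then have "(\<lambda>x. (x, y)) -` E = {}" unfolding E_def nbhd_def by auto
      then show ?thesis by simp
    qed
  qed
  also have "\<dots> = ennreal a * emeasure \<nu> (nbhd C r)"
    using N by (simp add: nn_integral_cmult_indicator)
  finally show ?thesis
    using ab by (simp add: \<mu>.emeasure_eq_measure \<nu>.emeasure_eq_measure ennreal_mult[symmetric] ennreal_le_iff)
qed

text \<open>The Fubini inequality compares \<mu> of \<open>C\<close> with \<nu> of a neighbourhood
  of \<open>C\<close>, up to the two ball masses. These agree and are positive, so they cancel, and
  the radius can tend to 0.\<close>

lemma uniform_on_balls_le:
  assumes comp: "compact_space mtopology" and \<mu>: "borel_prob mtopology \<mu>" and \<nu>: "borel_prob mtopology \<nu>"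
    and unif\<mu>: "\<And>x y r. x \<in> M \<Longrightarrow> y \<in> M \<Longrightarrow> measure \<mu> (mball x r) = measure \<mu> (mball y r)"
    and unif\<nu>: "\<And>x y r. x \<in> M \<Longrightarrow> y \<in> M \<Longrightarrow> measure \<nu> (mball x r) = measure \<nu> (mball y r)"
    and C: "closedin mtopology C"
  shows "measure \<mu> C \<le> measure \<nu> C"
proof -
  interpret \<mu>: prob_space \<mu> by (rule borel_prob_prob_space[OF \<mu>])
  interpret \<nu>: prob_space \<nu> by (rule borel_prob_prob_space[OF \<nu>])
  have sp: "space \<mu> = M" "space \<nu> = M" using space_borel_prob[OF \<mu>] space_borel_prob[OF \<nu>] by auto
  then obtain z where z: "z \<in> M" using \<mu>.not_empty by auto
  have le: "measure \<mu> C \<le> measure \<nu> (nbhd C r)" if "0 < r" for r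
  proof -
    define a where "a = measure \<mu> (mball z r)"
    define b where "b = measure \<nu> (mball z r)"
    have a: "measure \<mu> (mball x r) = a" and b: "measure \<nu> (mball x r) = b" if "x \<in> M" for x
      unfolding a_def b_def by (rule unif\<mu>[OF that z], rule unif\<nu>[OF that z])
    \<comment> \<open>For the whole space the neighbourhood adds nothing, so the Fubini inequality
      in both orders gives \<open>a = b\<close>.\<close>
    have N: "nbhd M r = M" unfolding nbhd_def using that by auto
    have M: "closedin mtopology M" "measure \<mu> M = 1" "measure \<nu> M = 1"
      using \<mu>.prob_space \<nu>.prob_space sp closedin_topspace[of mtopology] by auto
    have "b \<le> a" using uniform_on_balls_Fubini[OF comp \<mu> \<nu> a b M(1)] N M by simp
    moreover have "a \<le> b" using uniform_on_balls_Fubini[OF comp \<nu> \<mu> b a M(1)] N M by simp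
    ultimately have "a = b" by simp
    have "b \<noteq> 0"
    proof
      assume "b = 0"
      obtain K where K: "finite K" "K \<subseteq> M" "M \<subseteq> (\<Union>x\<in>K. mball x r)"
        using compactin_imp_mtotally_bounded[of M] comp \<open>0 < r\<close>
        unfolding mtotally_bounded_def by (auto simp: compact_space_def)
      have "(\<Union>x\<in>K. mball x r) \<in> null_sets \<nu>"
        using K(1,2) b \<open>b = 0\<close> openin_in_sets_borel_prob[OF \<nu>]
        by (intro null_sets.finite_UN) (auto simp: null_sets_def \<nu>.emeasure_eq_measure)
      then have "measure \<nu> (\<Union>x\<in>K. mball x r) = 0" "(\<Union>x\<in>K. mball x r) \<in> sets \<nu>"
        by (auto simp: null_sets_def measure_def)
      then show False using \<nu>.finite_measure_mono[OF K(3)] M(3) by simp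
    qed
    moreover have "0 \<le> b" unfolding b_def by simp
    ultimately show ?thesis
      using uniform_on_balls_Fubini[OF comp \<mu> \<nu> a b C] \<open>a = b\<close> by simp
  qed
  define B where "B n = nbhd C (1 / Suc n)" for n :: nat
  have "decseq B"
    unfolding B_def nbhd_def antimono_def
    by (intro allI impI UN_mono mball_subset_concentric) (simp_all add: frac_le)
  moreover have "range B \<subseteq> sets \<nu>"
    unfolding B_def using openin_in_sets_borel_prob[OF \<nu> openin_nbhd] by auto
  ultimately have "(\<lambda>n. measure \<nu> (B n)) \<longlonglongrightarrow> measure \<nu> (\<Inter>n. B n)"
    by (intro \<nu>.finite_Lim_measure_decseq)
  then have "(\<lambda>n. measure \<nu> (B n)) \<longlonglongrightarrow> measure \<nu> C"
    unfolding B_def nbhd_Inter[OF C] .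
  then show ?thesis
    by (rule LIMSEQ_le_const) (use le in \<open>auto simp: B_def\<close>)
qed

theorem uniform_on_balls_unique:
  assumes "compact_space mtopology" "borel_prob mtopology \<mu>" "borel_prob mtopology \<nu>"
    and "\<And>x y r. x \<in> M \<Longrightarrow> y \<in> M \<Longrightarrow> measure \<mu> (mball x r) = measure \<mu> (mball y r)"
    and "\<And>x y r. x \<in> M \<Longrightarrow> y \<in> M \<Longrightarrow> measure \<nu> (mball x r) = measure \<nu> (mball y r)"
  shows "\<mu> = \<nu>"
proof (rule borel_prob_eqI[OF assms(2,3)])
  fix C assume C: "closedin mtopology C"
  show "measure \<mu> C = measure \<nu> C"
    by (rule antisym[OF uniform_on_balls_le[OF assms C] uniform_on_balls_le[OF assms(1,3,2,5,4) C]])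
qed

end


section \<open>Minimal isometric actions\<close>

lemma Metric_space_transport:
  assumes "Metric_space M d" and e: "homeomorphic_maps (Metric_space.mtopology M d) Y e e'"
  shows "Metric_space (topspace Y) (\<lambda>x y. d (e' x) (e' y))"
    and "Metric_space.mtopology (topspace Y) (\<lambda>x y. d (e' x) (e' y)) = Y"
proof -
  interpret Metric_space M d by (rule assms(1))
  have e'_in: "e' y \<in> M" if "y \<in> topspace Y" for y
    using e that unfolding homeomorphic_maps_def continuous_map_def by auto
  have ee': "e (e' y) = y" if "y \<in> topspace Y" for y
    using e that unfolding homeomorphic_maps_def by blast
  have hom: "homeomorphic_map Y mtopology e'" using e homeomorphic_maps_sym homeomorphic_map_maps by blast
  have inj: "e' x = e' y \<longleftrightarrow> x = y" if "x \<in> topspace Y" "y \<in> topspace Y" for x y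
    using ee' that by metis
  then have inj_on: "inj_on e' (topspace Y)" by (simp add: inj_on_def)
  have surj: "e' ` topspace Y = M" using homeomorphic_imp_surjective_map[OF hom] by simp
  show "Metric_space (topspace Y) (\<lambda>x y. d (e' x) (e' y))"
    by (unfold_locales) (use e'_in inj commute triangle in auto)
  then interpret Y: Metric_space "topspace Y" "\<lambda>x y. d (e' x) (e' y)" .
  have ball: "e' ` Y.mball y r = mball (e' y) r" if "y \<in> topspace Y" for y r
  proof
    show "e' ` Y.mball y r \<subseteq> mball (e' y) r" using e'_in by auto
    show "mball (e' y) r \<subseteq> e' ` Y.mball y r"
    proof
      fix x assume x: "x \<in> mball (e' y) r"
      then obtain z where "z \<in> topspace Y" "x = e' z" using surj by (metis imageE in_mball)
      then show "x \<in> e' ` Y.mball y r" using x that by auto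
    qed
  qed
  have "openin Y.mtopology V \<longleftrightarrow> openin Y V" for V
  proof (cases "V \<subseteq> topspace Y")
    case True
    have "Y.mball y r \<subseteq> V \<longleftrightarrow> mball (e' y) r \<subseteq> e' ` V" if "y \<in> V" for y r
    proof -
      have "Y.mball y r \<subseteq> V \<longleftrightarrow> e' ` Y.mball y r \<subseteq> e' ` V"
        using inj_on_image_subset_iff[OF inj_on Y.mball_subset_mspace True] by simp
      moreover have "e' ` Y.mball y r = mball (e' y) r" using True that by (intro ball) auto
      ultimately show ?thesis by simp
    qed
    then have "openin Y.mtopology V \<longleftrightarrow> openin mtopology (e' ` V)"
      using True e'_in unfolding Y.openin_mtopology openin_mtopology by auto
    then show ?thesis using homeomorphic_map_openness[OF hom True] by simp
  next
    case False
    then show ?thesis using openin_subset[of Y V] Y.openin_mtopology by auto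
  qed
  then show "Y.mtopology = Y" by (simp add: topology_eq)
qed

locale isometric_minimal_G_space = compact_G_space + Metric_space "topspace X" d for d +
  assumes mtopology_eq: "mtopology = X"
    and isometric: "\<And>g x y. g \<in> carrier G \<Longrightarrow> x \<in> topspace X \<Longrightarrow> y \<in> topspace X \<Longrightarrow> d (\<phi> g x) (\<phi> g y) = d x y"
    and minimal: "minimal_subset G X \<phi> (topspace X)"
begin

lemma openin_mball_X: "openin X (mball x r)"
  using openin_mball[of x r] unfolding mtopology_eq .

text \<open>An isometry of the group moves the centre \<open>x\<close> close to \<open>y\<close>, so
  it carries a slightly smaller ball around \<open>x\<close> into the ball around
  \<open>y\<close>.\<close>

lemma invariant_measure_mball_le:
  assumes \<mu>: "invariant_prob G X \<phi> \<mu>" and x: "x \<in> topspace X" and y: "y \<in> topspace X"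
  shows "measure \<mu> (mball x r) \<le> measure \<mu> (mball y r)"
proof -
  have prob: "borel_prob X \<mu>" using \<mu> unfolding invariant_prob_def by simp
  interpret \<mu>: prob_space \<mu> by (rule borel_prob_prob_space[OF prob])
  have sets: "mball z s \<in> sets \<mu>" for z s by (rule openin_in_sets_borel_prob[OF prob openin_mball_X])
  \<comment> \<open>Minimality brings \<open>x\<close> only within \<open>1 / Suc n\<close> of
    \<open>y\<close>; the radius gives up that much, and the union over \<open>n\<close> recovers
    the full ball.\<close>
  define B where "B n = mball x (r - 1 / Suc n)" for n :: nat
  have le: "measure \<mu> (B n) \<le> measure \<mu> (mball y r)" for n
  proof -
    have "mball y (1 / Suc n) \<inter> topspace X \<noteq> {}" using y centre_in_mball_iff by fastforce
    then obtain g where g: "g \<in> carrier G" "\<phi> g x \<in> mball y (1 / Suc n)"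
      using minimal_orbit_meets[OF minimal x openin_mball_X] by blast
    have "\<phi> g ` B n \<subseteq> mball y r"
    proof
      fix z assume "z \<in> \<phi> g ` B n"
      then obtain u where u: "z = \<phi> g u" "u \<in> topspace X" "d x u < r - 1 / Suc n" unfolding B_def by auto
      have "d y z \<le> d y (\<phi> g x) + d (\<phi> g x) z" using triangle y act_in g(1) x u by auto
      also have "d (\<phi> g x) z = d x u" using isometric[OF g(1) x u(2)] u(1) by simp
      finally show "z \<in> mball y r" using u y act_in[OF g(1) u(2)] g(2) by simp
    qed
    then have "measure \<mu> (\<phi> g ` B n) \<le> measure \<mu> (mball y r)" using sets by (intro \<mu>.finite_measure_mono)
    then show ?thesis using act_image_measure[OF \<mu> g(1), of "B n"] sets unfolding B_def by simp
  qed
  have "incseq B"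
    unfolding B_def incseq_def by (intro allI impI mball_subset_concentric) (simp add: frac_le)
  moreover have "range B \<subseteq> sets \<mu>" using sets unfolding B_def by auto
  ultimately have "(\<lambda>n. measure \<mu> (B n)) \<longlonglongrightarrow> measure \<mu> (\<Union>n. B n)"
    by (intro \<mu>.finite_Lim_measure_incseq)
  moreover have "(\<Union>n. B n) = mball x r"
  proof
    show "(\<Union>n. B n) \<subseteq> mball x r" unfolding B_def by (intro UN_least mball_subset_concentric) simp
    show "mball x r \<subseteq> (\<Union>n. B n)"
    proof
      fix z assume z: "z \<in> mball x r"
      then obtain n :: nat where "1 / Suc n < r - d x z" using nat_approx_posE[of "r - d x z"] by auto
      then have "z \<in> B n" unfolding B_def using z by simp
      then show "z \<in> (\<Union>n. B n)" by blast
    qed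
  qed
  ultimately show ?thesis using LIMSEQ_le_const2[of _ "measure \<mu> (mball x r)"] le by auto
qed

lemma invariant_measure_mball:
  assumes "invariant_prob G X \<phi> \<mu>" "x \<in> topspace X" "y \<in> topspace X"
  shows "measure \<mu> (mball x r) = measure \<mu> (mball y r)"
  using invariant_measure_mball_le assms by (intro antisym) auto

text \<open>Membership in the closure lets a group element, which is an isometry, imitate
  \<open>k\<close> at two given points up to any error.\<close>

lemma enveloping_isometry:
  assumes k: "k \<in> enveloping_group G X \<phi>"
  shows "homeomorphic_map X X k"
    and "\<And>x y. x \<in> topspace X \<Longrightarrow> y \<in> topspace X \<Longrightarrow> d (k x) (k y) = d x y"
proof -
  define T where "T C U = {f \<in> extensional (topspace X). homeomorphic_map X X f \<and> f ` C \<subseteq> U}" for C U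
  have top: "homeo_topology X = topology_generated_by {T C U | C U. compactin X C \<and> openin X U}"
    unfolding homeo_topology_def T_def ..
  have T: "openin (homeo_topology X) (T C U)" if "compactin X C" "openin X U" for C U
    unfolding top using that by (intro topology_generated_by_Basis) blast
  have "k \<in> topspace (homeo_topology X)"
    using k closure_of_subset_topspace[of "homeo_topology X"] unfolding enveloping_group_def by auto
  then have k': "k \<in> extensional (topspace X)" "homeomorphic_map X X k"
    unfolding top topology_generated_by_topspace T_def by auto
  then show "homeomorphic_map X X k" by simp
  have k_in: "k x \<in> topspace X" if "x \<in> topspace X" for x
    using homeomorphic_imp_surjective_map[OF k'(2)] that by auto
  fix x y assume xy: "x \<in> topspace X" "y \<in> topspace X"
  have approx: "\<bar>d (k x) (k y) - d x y\<bar> \<le> 2 * \<epsilon>" if "0 < \<epsilon>" for \<epsilon>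
  proof -
    \<comment> \<open>Singletons are compact, so subbasic sets of the compact-open topology already
      control single values.\<close>
    define W where "W = T {x} (mball (k x) \<epsilon>) \<inter> T {y} (mball (k y) \<epsilon>)"
    have "openin (homeo_topology X) W"
      unfolding W_def using xy openin_mball_X by (intro openin_Int T) auto
    moreover have "k \<in> W" unfolding W_def T_def using k' k_in xy \<open>0 < \<epsilon>\<close> by simp
    ultimately obtain g where g: "g \<in> carrier G" "\<phi> g \<in> W"
      using k unfolding enveloping_group_def in_closure_of by blast
    have close: "d (k x) (\<phi> g x) < \<epsilon>" "d (k y) (\<phi> g y) < \<epsilon>"
      using g(2) unfolding W_def T_def by auto
    have iso: "d (\<phi> g x) (\<phi> g y) = d x y" using isometric[OF g(1) xy] .
    have "\<phi> g x \<in> topspace X" "\<phi> g y \<in> topspace X" "k x \<in> topspace X" "k y \<in> topspace X"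
      using act_in[OF g(1)] k_in xy by auto
    then have "d (k x) (k y) \<le> d (k x) (\<phi> g x) + d (\<phi> g x) (\<phi> g y) + d (k y) (\<phi> g y)"
      "d (\<phi> g x) (\<phi> g y) \<le> d (k x) (\<phi> g x) + d (k x) (k y) + d (k y) (\<phi> g y)"
      using triangle[of "k x" "\<phi> g x" "k y"] triangle[of "\<phi> g x" "\<phi> g y" "k y"]
        triangle[of "\<phi> g x" "k x" "\<phi> g y"] triangle[of "k x" "k y" "\<phi> g y"]
        commute[of "k x" "\<phi> g x"] commute[of "k y" "\<phi> g y"]
      by simp_all
    then show ?thesis using close iso by linarith
  qed
  have "\<bar>d (k x) (k y) - d x y\<bar> \<le> 0"
  proof (rule field_le_epsilon)
    fix e :: real assume "0 < e"
    then show "\<bar>d (k x) (k y) - d x y\<bar> \<le> 0 + e" using approx[of "e / 2"] by simp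
  qed
  then show "d (k x) (k y) = d x y" by simp
qed

lemma invariant_prob_unique:
  assumes "invariant_prob G X \<phi> \<mu>" "invariant_prob G X \<phi> \<nu>"
  shows "\<mu> = \<nu>"
proof (rule uniform_on_balls_unique)
  show "compact_space mtopology" "borel_prob mtopology \<mu>" "borel_prob mtopology \<nu>"
    using assms compact by (auto simp: mtopology_eq invariant_prob_def)
qed (fact invariant_measure_mball[OF assms(1)] invariant_measure_mball[OF assms(2)])+

text \<open>\<open>k\<close> need not commute with the action, so the push-forward is not compared
  via \<open>G\<close>-invariance. Preimages of balls under a surjective isometry are balls of the
  same radius, hence the push-forward is again uniform on balls.\<close>

lemma enveloping_invariant:
  assumes \<mu>: "invariant_prob G X \<phi> \<mu>" and k: "k \<in> enveloping_group G X \<phi>"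
  shows "distr \<mu> (borel_of X) k = \<mu>"
proof -
  have prob: "borel_prob X \<mu>" using \<mu> unfolding invariant_prob_def by simp
  interpret \<mu>: prob_space \<mu> by (rule borel_prob_prob_space[OF prob])
  note hom = enveloping_isometry(1)[OF k] and iso = enveloping_isometry(2)[OF k]
  have k_surj: "k ` topspace X = topspace X" using homeomorphic_imp_surjective_map[OF hom] .
  then have k_in: "k y \<in> topspace X" if "y \<in> topspace X" for y using that by auto
  have meas: "k \<in> measurable \<mu> (borel_of X)"
    using continuous_map_measurable[OF homeomorphic_imp_continuous_map[OF hom]]
      measurable_cong_sets[OF sets_borel_prob[OF prob] refl] by blast
  have prob': "borel_prob X (distr \<mu> (borel_of X) k)"
    unfolding borel_prob_def using \<mu>.prob_space_distr[OF meas] by simp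
  have ball: "\<exists>u\<in>topspace X. measure (distr \<mu> (borel_of X) k) (mball x r) = measure \<mu> (mball u r)"
    if x: "x \<in> topspace X" for x r
  proof -
    obtain u where u: "u \<in> topspace X" "x = k u" using x k_surj by blast
    have "k -` mball x r \<inter> space \<mu> = mball u r"
      using iso[OF u(1)] u k_in space_borel_prob[OF prob] by auto
    then show ?thesis
      using measure_distr[OF meas openin_in_sets_borel_of[OF openin_mball_X]] u(1) by auto
  qed
  show ?thesis
  proof (rule uniform_on_balls_unique)
    fix x y r assume "x \<in> topspace X" "y \<in> topspace X"
    then obtain u v where "u \<in> topspace X" "v \<in> topspace X"
      "measure (distr \<mu> (borel_of X) k) (mball x r) = measure \<mu> (mball u r)"
      "measure (distr \<mu> (borel_of X) k) (mball y r) = measure \<mu> (mball v r)"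
      using ball by metis
    then show "measure (distr \<mu> (borel_of X) k) (mball x r) = measure (distr \<mu> (borel_of X) k) (mball y r)"
      using invariant_measure_mball[OF \<mu>, of u v r] by simp
  next
    show "compact_space mtopology" "borel_prob mtopology (distr \<mu> (borel_of X) k)" "borel_prob mtopology \<mu>"
      using compact prob prob' by (simp_all add: mtopology_eq)
  qed (fact invariant_measure_mball[OF \<mu>])
qed

lemma act_in_enveloping_group:
  assumes "g \<in> carrier G"
  shows "\<phi> g \<in> enveloping_group G X \<phi>"
proof -
  have "\<phi> h \<in> topspace (homeo_topology X)" if "h \<in> carrier G" for h
  proof -
    \<comment> \<open>With \<open>C\<close> and \<open>U\<close> both empty the generator consists
      of all extensional homeomorphisms.\<close>
    have "\<phi> h \<in> {f \<in> extensional (topspace X). homeomorphic_map X X f \<and> f ` {} \<subseteq> {}}"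
      using act_extensional act_homeomorphic that by auto
    moreover have "compactin X {}" "openin X {}" by auto
    ultimately show ?thesis
      unfolding homeo_topology_def topology_generated_by_topspace by blast
  qed
  then have "\<phi> ` carrier G \<subseteq> enveloping_group G X \<phi>"
    unfolding enveloping_group_def by (intro closure_of_subset) auto
  then show ?thesis using assms by blast
qed

theorem invariant_prob_unique_and_haar:
  assumes \<mu>: "invariant_prob G X \<phi> \<mu>"
  shows "unique_invariant_prob G X \<phi> \<mu>" and "haar_measure G X \<phi> \<mu>"
proof -
  show "unique_invariant_prob G X \<phi> \<mu>"
    unfolding unique_invariant_prob_def using \<mu> invariant_prob_unique by blast
  have "enveloping_invariant_prob G X \<phi> \<mu>"
    unfolding enveloping_invariant_prob_def using \<mu> enveloping_invariant[OF \<mu>]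
    by (auto simp: invariant_prob_def)
  moreover have "\<nu> = \<mu>" if "enveloping_invariant_prob G X \<phi> \<nu>" for \<nu>
    using that \<mu> act_in_enveloping_group
    by (intro invariant_prob_unique) (auto simp: invariant_prob_def enveloping_invariant_prob_def)
  ultimately show "haar_measure G X \<phi> \<mu>" unfolding haar_measure_def by blast
qed

end


section \<open>Minimal subsets\<close>

lemma restrict_space_space: "restrict_space N (space N) = N"
proof (rule measure_eqI)
  have "(\<inter>) (space N) ` sets N = sets N"
    using sets.Int_space_eq1 by (force simp: image_iff)
  then show sets: "sets (restrict_space N (space N)) = sets N"
    by (simp add: sets_restrict_space)
  fix A assume "A \<in> sets (restrict_space N (space N))"
  then show "emeasure (restrict_space N (space N)) A = emeasure N A"
    using sets.sets_into_space sets by (intro emeasure_restrict_space) auto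
qed

section \<open>Transport of measures and topologies between systems\<close>

lemma push_invariant_prob:
  assumes \<mu>: "invariant_prob G X \<phi> \<mu>" and f: "continuous_map X Y f"
    and \<phi>: "\<And>g. g \<in> carrier G \<Longrightarrow> continuous_map X X (\<phi> g)"
    and \<psi>: "\<And>g. g \<in> carrier G \<Longrightarrow> continuous_map Y Y (\<psi> g)"
    and equiv: "\<And>g x. g \<in> carrier G \<Longrightarrow> x \<in> topspace X \<Longrightarrow> f (\<phi> g x) = \<psi> g (f x)"
  shows "invariant_prob G Y \<psi> (distr \<mu> (borel_of Y) f)"
proof -
  have prob: "borel_prob X \<mu>" and inv: "\<And>g. g \<in> carrier G \<Longrightarrow> distr \<mu> (borel_of X) (\<phi> g) = \<mu>"
    using \<mu> unfolding invariant_prob_def by auto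
  interpret prob_space \<mu> by (rule borel_prob_prob_space[OF prob])
  have meas: "h \<in> measurable \<mu> (borel_of W)" if "continuous_map X W h" for h and W :: "'w topology"
    using continuous_map_measurable[OF that] measurable_cong_sets[OF sets_borel_prob[OF prob] refl] by blast
  have "borel_prob Y (distr \<mu> (borel_of Y) f)"
    unfolding borel_prob_def using prob_space_distr[OF meas[OF f]] by simp
  moreover have "distr (distr \<mu> (borel_of Y) f) (borel_of Y) (\<psi> g) = distr \<mu> (borel_of Y) f"
    if g: "g \<in> carrier G" for g
  proof -
    have "distr (distr \<mu> (borel_of Y) f) (borel_of Y) (\<psi> g) = distr \<mu> (borel_of Y) (\<psi> g \<circ> f)"
      by (rule distr_distr[OF continuous_map_measurable[OF \<psi>[OF g]] meas[OF f]])
    also have "\<dots> = distr \<mu> (borel_of Y) (f \<circ> \<phi> g)"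
      using equiv[OF g] space_borel_prob[OF prob] by (intro distr_cong) auto
    also have "\<dots> = distr (distr \<mu> (borel_of X) (\<phi> g)) (borel_of Y) f"
      by (rule distr_distr[symmetric, OF continuous_map_measurable[OF f] meas[OF \<phi>[OF g]]])
    finally show ?thesis using inv[OF g] by simp
  qed
  ultimately show ?thesis unfolding invariant_prob_def by blast
qed

text \<open>Serves to copy a space into another type along an arbitrary injection.\<close>

lemma homeomorphic_maps_pullback:
  assumes inj: "inj_on F (topspace X)"
  shows "homeomorphic_maps X (pullback_topology (F ` topspace X) (inv_into (topspace X) F) X)
    F (inv_into (topspace X) F)"
proof -
  let ?F' = "inv_into (topspace X) F"
  have "continuous_map X (pullback_topology (F ` topspace X) ?F' X) F"
  proof (rule continuous_map_pullback')
    show "continuous_map X X (?F' \<circ> F)"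
      by (rule continuous_map_eq[OF continuous_map_id]) (simp add: inj)
  qed auto
  moreover have "continuous_map (pullback_topology (F ` topspace X) ?F' X) X (id \<circ> ?F')"
    by (rule continuous_map_pullback) auto
  ultimately show ?thesis
    unfolding homeomorphic_maps_def using inj
    by (auto simp: topspace_pullback_topology f_inv_into_f)
qed

lemma topspace_pullback_image:
  "topspace (pullback_topology (F ` topspace X) (inv_into (topspace X) F) X) = F ` topspace X"
  by (auto simp: topspace_pullback_topology inv_into_into)

context compact_G_space
begin

text \<open>A dense orbit \<open>G y\<close> embeds the space into the type over which amenability quantifies:
  a point \<open>z\<close> is determined by the sets \<open>A\<close> of group elements with \<open>z \<in> closure (A y)\<close>.\<close>

lemma amenable_minimal_invariant_prob:
  assumes amen: "amenable_group G TG" and min: "minimal_subset G X \<phi> (topspace X)"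
  shows "\<exists>\<mu>. invariant_prob G X \<phi> \<mu>"
proof -
  obtain y where y: "y \<in> topspace X" using min unfolding minimal_subset_def by (metis ex_in_conv)
  \<comment> \<open>A set of group elements is coded as the level set of \<open>f\<close> at 1, and
    \<open>F z\<close> is the indicator of the sets whose part of the orbit accumulates at
    \<open>z\<close>.\<close>
  define F :: "'x \<Rightarrow> ('g \<Rightarrow> real) \<Rightarrow> real" where
    "F z = (\<lambda>f. if z \<in> X closure_of ((\<lambda>g. \<phi> g y) ` {g \<in> carrier G. f g = 1}) then 1 else 0)" for z
  have "inj_on F (topspace X)"
  proof (rule inj_onI, rule ccontr)
    fix z w assume zw: "z \<in> topspace X" "w \<in> topspace X" "F z = F w" "z \<noteq> w"
    then obtain U V where UV: "openin X U" "openin X V" "z \<in> U" "w \<in> V" "disjnt U V"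
      using Hausdorff unfolding Hausdorff_space_def by metis
    \<comment> \<open>The times at which the orbit of \<open>y\<close> visits \<open>U\<close> tell
      \<open>z\<close> from \<open>w\<close>: the visits accumulate at \<open>z\<close> because the
      orbit is dense, and stay away from \<open>w\<close> because \<open>V\<close> is disjoint from
      \<open>U\<close>.\<close>
    define f :: "'g \<Rightarrow> real" where "f g = (if \<phi> g y \<in> U then 1 else 0)" for g
    have f: "{g \<in> carrier G. f g = 1} = {g \<in> carrier G. \<phi> g y \<in> U}" unfolding f_def by auto
    have "z \<in> X closure_of ((\<lambda>g. \<phi> g y) ` {g \<in> carrier G. \<phi> g y \<in> U})"
      unfolding in_closure_of
    proof (intro conjI allI impI)
      fix T assume T: "z \<in> T \<and> openin X T"
      then have "openin X (T \<inter> U)" "T \<inter> U \<inter> topspace X \<noteq> {}" using UV zw(1) by auto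
      then obtain g where "g \<in> carrier G" "\<phi> g y \<in> T \<inter> U"
        using minimal_orbit_meets[OF min y] by blast
      then show "\<exists>x. x \<in> (\<lambda>g. \<phi> g y) ` {g \<in> carrier G. \<phi> g y \<in> U} \<and> x \<in> T" by auto
    qed (rule zw(1))
    then have "F z f = 1" unfolding F_def f by simp
    moreover have "w \<notin> X closure_of ((\<lambda>g. \<phi> g y) ` {g \<in> carrier G. \<phi> g y \<in> U})"
      unfolding in_closure_of using UV(2,4,5) unfolding disjnt_def by auto
    then have "F w f = 0" unfolding F_def f by simp
    ultimately show False using zw(3) by simp
  qed
  note e = homeomorphic_maps_pullback[OF this]
  let ?Y = "pullback_topology (F ` topspace X) (inv_into (topspace X) F) X"
  let ?F' = "inv_into (topspace X) F"
  let ?\<psi> = "\<lambda>g. \<lambda>p\<in>topspace ?Y. F (\<phi> g (?F' p))"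
  have sys: "compact_system G TG ?Y ?\<psi>" by (rule compact_system_transport[OF e])
  interpret Y: compact_G_space G TG ?Y ?\<psi>
    by (rule compact_G_space.intro[OF topological_group sys])
  have "topspace ?Y \<noteq> {}" using y unfolding topspace_pullback_image by auto
  then obtain \<nu> where \<nu>: "invariant_prob G ?Y ?\<psi> \<nu>"
    using amen sys unfolding amenable_group_def by blast
  have "invariant_prob G X \<phi> (distr \<nu> (borel_of X) ?F')"
  proof (rule push_invariant_prob[OF \<nu> _ Y.act_continuous act_continuous])
    show "continuous_map ?Y X ?F'" using e unfolding homeomorphic_maps_def by simp
    fix g p assume g: "g \<in> carrier G" and p: "p \<in> topspace ?Y"
    have "?F' p \<in> topspace X" using p unfolding topspace_pullback_image by (rule inv_into_into)
    then have "?F' (F (\<phi> g (?F' p))) = \<phi> g (?F' p)"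
      using e act_in[OF g] unfolding homeomorphic_maps_def by blast
    then show "?F' (?\<psi> g p) = \<phi> g (?F' p)" using p by simp
  qed
  then show ?thesis by blast
qed

end

lemma (in isometric_minimal_G_space) equicontinuous: "equicontinuous_system G TG X \<phi>"
  unfolding equicontinuous_system_def
proof (intro conjI exI[of _ d] allI impI)
  fix \<epsilon> :: real assume "0 < \<epsilon>"
  then show "\<exists>\<delta>>0. \<forall>g\<in>carrier G. \<forall>x\<in>topspace X. \<forall>y\<in>topspace X. d x y < \<delta> \<longrightarrow> d (\<phi> g x) (\<phi> g y) < \<epsilon>"
    using isometric by (intro exI[of _ \<epsilon>]) simp
qed (use system mtopology_eq Metric_space_axioms in auto)

lemma (in isometric_minimal_G_space) metrizable: "metrizable_space X"
  using metrizable_space_mtopology unfolding mtopology_eq .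

text \<open>Minimal subsets are themselves equicontinuous, so the equicontinuous factor is a copy of \<open>M\<close>
  on singletons and the factor map is a homeomorphism.\<close>

theorem (in compact_G_space) minimal_subset_structure:
  assumes amen: "amenable_group G TG" and X: "dendrite X" and M: "minimal_subset G X \<phi> M"
  shows "\<exists>(Z :: 'x set topology) \<psi> \<iota>.
    minimal_system G TG Z \<psi> \<and> equicontinuous_system G TG Z \<psi> \<and>
    almost_one_to_one_extension G TG (subtopology X M) (restrict_action \<phi> M) Z \<psi> \<iota> \<and>
    (\<exists>\<mu> \<nu>.
      unique_invariant_prob G (subtopology X M) (restrict_action \<phi> M) \<mu> \<and>
      haar_measure G Z \<psi> \<nu> \<and>
      measure_isomorphism G (restrict_action \<phi> M) \<mu> \<psi> \<nu> \<iota>)"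
proof -
  let ?S = "subtopology X M" and ?\<phi> = "restrict_action \<phi> M"
  have closed: "closedin X M" and inv: "invariant_set G \<phi> M"
    using M unfolding minimal_subset_def by auto
  have top: "topspace ?S = M" using closedin_subset[OF closed] by auto
  interpret S: compact_G_space G TG ?S ?\<phi>
    by (rule compact_G_space.intro[OF topological_group compact_system_restrict[OF closed inv]])
  note minS = minimal_subset_subtopology[OF M]
  obtain \<mu> where \<mu>: "invariant_prob G ?S ?\<phi> \<mu>"
    using S.amenable_minimal_invariant_prob[OF amen minS] by blast
  have prob: "borel_prob ?S \<mu>" using \<mu> unfolding invariant_prob_def by simp
  interpret \<mu>: prob_space \<mu> by (rule borel_prob_prob_space[OF prob])
  have sp: "space \<mu> = M" using space_borel_prob[OF prob] top by simp
  have inc: "continuous_map ?S X (\<lambda>x. x)" by (simp add: continuous_map_from_subtopology)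
  \<comment> \<open>The halves that define the metric are subsets of \<open>X\<close>, so the
    measure has to be viewed on \<open>X\<close>.\<close>
  have \<mu>X: "invariant_prob G X \<phi> (distr \<mu> (borel_of X) (\<lambda>x. x))"
    by (rule push_invariant_prob[OF \<mu> inc S.act_continuous act_continuous])
      (auto simp: restrict_action_def)
  have "(\<lambda>x. x) \<in> measurable \<mu> (borel_of X)"
    using continuous_map_measurable[OF inc] measurable_cong_sets[OF sets_borel_prob[OF prob] refl] by blast
  then have "measure (distr \<mu> (borel_of X) (\<lambda>x. x)) M = measure \<mu> M"
    using closedin_in_sets_borel_of[OF closed] sp by (simp add: measure_distr)
  then have "measure (distr \<mu> (borel_of X) (\<lambda>x. x)) M = 1" using \<mu>.prob_space sp by simp
  then obtain d where d: "Metric_space M d" "Metric_space.mtopology M d = ?S"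
    "\<And>g x y. g \<in> carrier G \<Longrightarrow> x \<in> M \<Longrightarrow> y \<in> M \<Longrightarrow> d (\<phi> g x) (\<phi> g y) = d x y"
    using minimal_invariant_metric[OF X M \<mu>X] by metis
  interpret S: isometric_minimal_G_space G TG ?S ?\<phi> d
  proof (intro isometric_minimal_G_space.intro isometric_minimal_G_space_axioms.intro S.compact_G_space_axioms)
    show "Metric_space (topspace ?S) d" "Metric_space.mtopology (topspace ?S) d = ?S"
      using d(1,2) unfolding top by auto
    show "d (?\<phi> g x) (?\<phi> g y) = d x y" if "g \<in> carrier G" "x \<in> topspace ?S" "y \<in> topspace ?S" for g x y
      using that d(3)[of g x y] unfolding top restrict_action_def by simp
  qed (rule minS)
  let ?e = "\<lambda>x::'x. {x}"
  define e' where "e' = inv_into (topspace ?S) ?e"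
  define Z where "Z = pullback_topology (?e ` topspace ?S) e' ?S"
  define \<psi> where "\<psi> = (\<lambda>g. \<lambda>z\<in>topspace Z. ?e (?\<phi> g (e' z)))"
  have e: "homeomorphic_maps ?S Z ?e e'"
    unfolding Z_def e'_def by (rule homeomorphic_maps_pullback) simp
  have topZ: "topspace Z = ?e ` M" using topspace_pullback_image[of ?e ?S] unfolding Z_def e'_def top .
  have e'e: "e' {x} = x" if "x \<in> M" for x
    using that inv_into_f_f[of ?e M x] unfolding e'_def top by simp
  have \<psi>_e: "\<psi> g {x} = {\<phi> g x}" if "x \<in> M" for g x
    using that e'e unfolding \<psi>_def by (simp add: topZ restrict_action_def)
  interpret Z: compact_G_space G TG Z \<psi>
    unfolding \<psi>_def by (rule compact_G_space.intro[OF topological_group S.compact_system_transport[OF e]])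
  have e_S: "homeomorphic_maps S.mtopology Z ?e e'" using e unfolding S.mtopology_eq .
  interpret Z: isometric_minimal_G_space G TG Z \<psi> "\<lambda>x y. d (e' x) (e' y)"
  proof (intro isometric_minimal_G_space.intro isometric_minimal_G_space_axioms.intro Z.compact_G_space_axioms)
    show "Metric_space (topspace Z) (\<lambda>x y. d (e' x) (e' y))"
      "Metric_space.mtopology (topspace Z) (\<lambda>x y. d (e' x) (e' y)) = Z"
      by (rule Metric_space_transport[OF S.Metric_space_axioms e_S])+
    show "minimal_subset G Z \<psi> (topspace Z)"
      unfolding \<psi>_def by (rule S.minimal_subset_transport[OF e minS])
    fix g x y assume g: "g \<in> carrier G" and "x \<in> topspace Z" "y \<in> topspace Z"
    then obtain u v where uv: "u \<in> M" "v \<in> M" "x = {u}" "y = {v}" unfolding topZ by auto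
    then have "\<phi> g u \<in> M" "\<phi> g v \<in> M" using inv g unfolding invariant_set_def by auto
    then show "d (e' (\<psi> g x)) (e' (\<psi> g y)) = d (e' x) (e' y)"
      using uv d(3)[OF g uv(1,2)] by (simp add: \<psi>_e e'e)
  qed
  have ce: "continuous_map ?S Z ?e" and ce': "continuous_map Z ?S e'"
    using e unfolding homeomorphic_maps_def by auto
  have equiv: "?e (?\<phi> g x) = \<psi> g (?e x)" if "x \<in> M" for g x
    using that \<psi>_e by (simp add: restrict_action_def)
  define \<nu> where "\<nu> = distr \<mu> (borel_of Z) ?e"
  have \<nu>: "invariant_prob G Z \<psi> \<nu>"
    unfolding \<nu>_def using equiv top
    by (intro push_invariant_prob[OF \<mu> ce S.act_continuous Z.act_continuous]) auto
  have ext: "almost_one_to_one_extension G TG ?S ?\<phi> Z \<psi> ?e"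
  proof -
    have "singleton_fibre_points ?S ?e = topspace ?S" unfolding singleton_fibre_points_def by auto
    moreover have "factor_map G ?S ?\<phi> Z \<psi> ?e"
      unfolding factor_map_def using ce top topZ equiv by auto
    ultimately show ?thesis
      unfolding almost_one_to_one_extension_def minimal_system_def
      using S.system Z.system S.minimal Z.minimal S.metrizable Z.metrizable
        gdelta_in_topspace[of ?S] closure_of_topspace[of ?S] by simp
  qed
  have iso: "measure_isomorphism G ?\<phi> \<mu> \<psi> \<nu> ?e"
    unfolding measure_isomorphism_def
  \<comment> \<open>The factor map is bijective everywhere, so no null sets have to be
    removed.\<close>
  proof (intro bexI[of _ M] bexI[of _ "topspace Z"] conjI)
    have sp\<nu>: "space \<nu> = topspace Z" unfolding \<nu>_def by simp
    have r\<mu>: "restrict_space \<mu> M = \<mu>" using restrict_space_space[of \<mu>] sp by simp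
    have r\<nu>: "restrict_space \<nu> (topspace Z) = \<nu>" using restrict_space_space[of \<nu>] sp\<nu> by simp
    have sets\<nu>: "sets \<nu> = sets (borel_of Z)" unfolding \<nu>_def by simp
    show "emeasure \<mu> (space \<mu> - M) = 0" "emeasure \<nu> (space \<nu> - topspace Z) = 0" using sp sp\<nu> by auto
    show "invariant_set G ?\<phi> M" "invariant_set G \<psi> (topspace Z)"
      using S.act_in[unfolded top] Z.act_in unfolding invariant_set_def by auto
    show "bij_betw ?e M (topspace Z)" unfolding topZ by (simp add: bij_betw_def)
    show "?e \<in> measurable (restrict_space \<mu> M) (restrict_space \<nu> (topspace Z))"
      unfolding r\<mu> r\<nu> using continuous_map_measurable[OF ce] sets_borel_prob[OF prob] sets\<nu>
        measurable_cong_sets by blast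
    show "inv_into M ?e \<in> measurable (restrict_space \<nu> (topspace Z)) (restrict_space \<mu> M)"
      unfolding r\<mu> r\<nu> using continuous_map_measurable[OF ce'] sets_borel_prob[OF prob] sets\<nu>
        measurable_cong_sets unfolding e'_def top by blast
    show "distr (restrict_space \<mu> M) (restrict_space \<nu> (topspace Z)) ?e = restrict_space \<nu> (topspace Z)"
      unfolding r\<mu> r\<nu> using sets\<nu> by (subst (2) \<nu>_def) (intro distr_cong, auto)
    show "\<forall>g\<in>carrier G. \<forall>x\<in>M. ?e (?\<phi> g x) = \<psi> g (?e x)" using equiv by blast
    show "M \<in> sets \<mu>" "topspace Z \<in> sets \<nu>" using sp sp\<nu> sets.top by metis+
  qed
  show ?thesis
    using Z.system Z.minimal Z.equicontinuous ext iso S.invariant_prob_unique_and_haar(1)[OF \<mu>]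
      Z.invariant_prob_unique_and_haar(2)[OF \<nu>]
    unfolding minimal_system_def by blast
qed


section \<open>Ergodic measures\<close>

lemma sets_borel_of_subtopology:
  assumes "closedin X S"
  shows "sets (borel_of (subtopology X S)) = sets (restrict_space (borel_of X) S)"
proof -
  have SX: "S \<subseteq> topspace X" using closedin_subset[OF assms] .
  have "S \<in> sigma_sets (topspace X) {U. openin X U}"
    using closedin_in_sets_borel_of[OF assms] unfolding sets_borel_of .
  then have "(\<inter>) S ` sigma_sets (topspace X) {U. openin X U} = sigma_sets S ((\<inter>) S ` {U. openin X U})"
    using SX by (intro sigma_sets_Int) auto
  moreover have "(\<inter>) S ` {U. openin X U} = {U. openin (subtopology X S) U}"
    by (auto simp: openin_subtopology Int_commute)
  ultimately show ?thesis
    using SX by (simp add: sets_restrict_space sets_borel_of Int_absorb1)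
qed

section \<open>The support of a measure\<close>

definition measure_support :: "'x topology \<Rightarrow> 'x measure \<Rightarrow> 'x set" where
  "measure_support X \<mu> = topspace X - \<Union>{U. openin X U \<and> measure \<mu> U = 0}"

lemma closedin_measure_support: "closedin X (measure_support X \<mu>)"
  unfolding measure_support_def by (intro closedin_diff openin_Union) auto

lemma measure_support_open_pos:
  assumes "openin X U" "U \<inter> measure_support X \<mu> \<noteq> {}"
  shows "0 < measure \<mu> U"
  using assms unfolding measure_support_def by (auto simp: zero_less_measure_iff)

text \<open>Uncountably many null open sets may be united. In a metrizable space their union is a
  countable union of closed sets, and each of these is compact, so finitely many of the null sets
  cover it.\<close>

lemma measure_measure_support:
  assumes X: "compact_space X" "metrizable_space X" and \<mu>: "borel_prob X \<mu>"
  shows "measure \<mu> (measure_support X \<mu>) = 1"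
proof -
  interpret prob_space \<mu> by (rule borel_prob_prob_space[OF \<mu>])
  define \<N> where "\<N> = {U. openin X U \<and> measure \<mu> U = 0}"
  have open_N: "openin X (\<Union>\<N>)" unfolding \<N>_def by (intro openin_Union) auto
  have null: "U \<in> null_sets \<mu>" if "U \<in> \<N>" for U
    using that openin_in_sets_borel_prob[OF \<mu>] unfolding \<N>_def by (auto simp: null_sets_def emeasure_eq_measure)
  have "fsigma_in X (\<Union>\<N>)"
    by (rule open_imp_fsigma_in[OF X(2) open_N])
  then obtain C :: "nat \<Rightarrow> 'a set" where C: "\<And>n. closedin X (C n)" "\<Union>(range C) = \<Union>\<N>"
    unfolding fsigma_in_ascending by metis
  have "C n \<in> null_sets \<mu>" for n
  proof -
    have "compactin X (C n)" using closedin_compact_space[OF X(1) C(1)] .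
    moreover have "C n \<subseteq> \<Union>\<N>" using C(2) by blast
    moreover have "\<forall>U\<in>\<N>. openin X U" unfolding \<N>_def by simp
    ultimately obtain \<F> where \<F>: "finite \<F>" "\<F> \<subseteq> \<N>" "C n \<subseteq> \<Union>\<F>"
      unfolding compactin_def by meson
    have "\<Union>\<F> \<in> null_sets \<mu>" using \<F>(1,2) null by (intro null_sets.finite_Union) auto
    then show ?thesis
      using null_sets_subset[OF _ closedin_in_sets_borel_prob[OF \<mu> C(1)] \<F>(3)] by simp
  qed
  then have "\<Union>\<N> \<in> null_sets \<mu>" unfolding C(2)[symmetric] by (intro null_sets_UN) auto
  then have "measure \<mu> (\<Union>\<N>) = 0" by (simp add: null_sets_def measure_def)
  then show ?thesis
    using prob_compl[OF openin_in_sets_borel_prob[OF \<mu> open_N]] space_borel_prob[OF \<mu>]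
    unfolding measure_support_def \<N>_def by simp
qed

context compact_G_space
begin

lemma invariant_closed_image:
  assumes g: "g \<in> carrier G" and A: "A \<subseteq> topspace X" "invariant_set G \<phi> A"
  shows "\<phi> g ` A = A"
proof
  show "\<phi> g ` A \<subseteq> A" using g A(2) unfolding invariant_set_def by blast
  show "A \<subseteq> \<phi> g ` A"
  proof
    fix x assume x: "x \<in> A"
    then have "\<phi> (inv\<^bsub>G\<^esub> g) x \<in> A" using g A(2) unfolding invariant_set_def by blast
    moreover have "x = \<phi> g (\<phi> (inv\<^bsub>G\<^esub> g) x)" using act_inv(2)[OF g] x A(1) by auto
    ultimately show "x \<in> \<phi> g ` A" by blast
  qed
qed

section \<open>Ergodic measures with an atom, and restriction to closed invariant sets\<close>

lemma ergodic_invariant_set: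
  assumes \<mu>: "ergodic_prob G X \<phi> \<mu>" and A: "A \<in> sets \<mu>" "invariant_set G \<phi> A"
  shows "measure \<mu> A = 0 \<or> measure \<mu> A = 1"
proof -
  have prob: "borel_prob X \<mu>" using \<mu> unfolding ergodic_prob_def invariant_prob_def by simp
  interpret prob_space \<mu> by (rule borel_prob_prob_space[OF prob])
  have AX: "A \<subseteq> topspace X" using sets.sets_into_space[OF A(1)] space_borel_prob[OF prob] by simp
  have "\<phi> g -` A \<inter> topspace X = A" if g: "g \<in> carrier G" for g
    using act_image[of "inv\<^bsub>G\<^esub> g" A] invariant_closed_image[of "inv\<^bsub>G\<^esub> g" A] g AX A(2) by simp
  then have "emeasure \<mu> A = 0 \<or> emeasure \<mu> A = 1"
    using \<mu> A(1) unfolding ergodic_prob_def by simp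
  then show ?thesis by (auto simp: measure_def)
qed

lemma invariant_Union_image:
  assumes "A \<subseteq> topspace X"
  shows "invariant_set G \<phi> (\<Union>g\<in>carrier G. \<phi> g ` A)"
  unfolding invariant_set_def
proof (intro ballI subsetI)
  fix g z assume g: "g \<in> carrier G" and "z \<in> \<phi> g ` (\<Union>g\<in>carrier G. \<phi> g ` A)"
  then obtain h x where h: "h \<in> carrier G" "x \<in> A" "z = \<phi> g (\<phi> h x)" by auto
  then have "z = \<phi> (g \<otimes>\<^bsub>G\<^esub> h) x" using action.composition_rule[of x g h] assms g by auto
  then show "z \<in> (\<Union>g\<in>carrier G. \<phi> g ` A)" using g h by (intro UN_I[of "g \<otimes>\<^bsub>G\<^esub> h"]) auto
qed

text \<open>The orbit of the atom is finite and invariant with positive measure, so it has full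
  measure by ergodicity, and invariance gives its points equal mass.\<close>

lemma ergodic_atom_uniform:
  assumes \<mu>: "ergodic_prob G X \<phi> \<mu>" and x: "x \<in> topspace X" "0 < measure \<mu> {x}"
  shows "finite (orbit G \<phi> x)" "\<mu> = uniform_distribution X (orbit G \<phi> x)"
proof -
  let ?F = "orbit G \<phi> x"
  have inv: "invariant_prob G X \<phi> \<mu>" and prob: "borel_prob X \<mu>"
    using \<mu> unfolding ergodic_prob_def invariant_prob_def by auto
  interpret prob_space \<mu> by (rule borel_prob_prob_space[OF prob])
  show fin: "finite ?F" by (rule finite_orbit_of_atom[OF inv x])
  have FX: "?F \<subseteq> topspace X" by (rule orbit_subset[OF x(1)])
  have closed: "closedin X A" if "A \<subseteq> ?F" for A
    using that fin FX Hausdorff by (meson closedin_Hausdorff_finite finite_subset order_trans)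
  then have sets: "A \<in> sets \<mu>" if "A \<subseteq> ?F" for A using that closedin_in_sets_borel_prob[OF prob] by blast
  have xF: "x \<in> ?F" using action.orbit_refl[OF x(1)] .
  have pt: "measure \<mu> {y} = measure \<mu> {x}" if "y \<in> ?F" for y
    using that act_image_measure[OF inv, of _ "{x}"] sets[of "{x}"] xF unfolding orbit_def by auto
  have card: "measure \<mu> A = card A * measure \<mu> {x}" if A: "A \<subseteq> ?F" for A
  proof -
    have "measure \<mu> A = (\<Sum>y\<in>A. measure \<mu> {y})"
      using A finite_subset[OF A fin] sets by (intro finite_measure_eq_sum_singleton) auto
    also have "\<dots> = card A * measure \<mu> {x}" using pt A by (simp add: subset_iff)
    finally show ?thesis .
  qed
  have "0 < card ?F" using fin xF by (auto simp: card_gt_0_iff)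
  then have "measure \<mu> ?F = 1"
    using ergodic_invariant_set[OF \<mu> sets[OF order_refl] invariant_orbit[OF x(1)]] card[of ?F] x(2) by auto
  then have c: "card ?F * measure \<mu> {x} = 1" and compl: "AE y in \<mu>. y \<in> ?F"
    using card[of ?F] AE_prob_1 by auto
  show "\<mu> = uniform_distribution X ?F"
  proof (rule measure_eqI)
    show "sets \<mu> = sets (uniform_distribution X ?F)"
      unfolding uniform_distribution_def using sets_borel_prob[OF prob] by simp
    fix A assume A: "A \<in> sets \<mu>"
    then have A': "A \<in> sets (borel_of X)" using sets_borel_prob[OF prob] by simp
    have "measure \<mu> A = measure \<mu> (A \<inter> ?F)"
      using compl A sets[of ?F] by (intro finite_measure_eq_AE) auto
    also have "\<dots> = card (A \<inter> ?F) / card ?F"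
      using card[of "A \<inter> ?F"] c \<open>0 < card ?F\<close> by (simp add: field_simps)
    finally have "emeasure \<mu> A = ennreal (card (A \<inter> ?F) / card ?F)" by (simp add: emeasure_eq_measure)
    also have "\<dots> = emeasure (uniform_count_measure ?F) (A \<inter> ?F)"
      using fin by (simp add: emeasure_uniform_count_measure)
    also have "\<dots> = emeasure (uniform_distribution X ?F) A"
      unfolding uniform_distribution_def using A' FX
      by (subst emeasure_distr) (auto simp: space_uniform_count_measure sets_uniform_count_measure measurable_def)
    finally show "emeasure \<mu> A = emeasure (uniform_distribution X ?F) A" .
  qed
qed

lemma invariant_measure_support:
  assumes \<mu>: "invariant_prob G X \<phi> \<mu>"
  shows "invariant_set G \<phi> (measure_support X \<mu>)"
  unfolding invariant_set_def
proof (intro ballI subsetI)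
  have prob: "borel_prob X \<mu>" using \<mu> unfolding invariant_prob_def by simp
  fix g z assume g: "g \<in> carrier G" and "z \<in> \<phi> g ` measure_support X \<mu>"
  then obtain x where x: "x \<in> topspace X" "z = \<phi> g x" "x \<in> measure_support X \<mu>"
    unfolding measure_support_def by auto
  have "z \<notin> U" if U: "openin X U" "measure \<mu> U = 0" for U
  proof
    assume "z \<in> U"
    have g': "inv\<^bsub>G\<^esub> g \<in> carrier G" using g by simp
    have "x \<in> \<phi> (inv\<^bsub>G\<^esub> g) ` U" using act_inv(1)[OF g x(1)] x(2) \<open>z \<in> U\<close> by (metis imageI)
    then have "0 < measure \<mu> (\<phi> (inv\<^bsub>G\<^esub> g) ` U)"
      using x(3) by (intro measure_support_open_pos[OF act_image_openin[OF g' U(1)]]) auto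
    then show False
      using act_image_measure[OF \<mu> g' openin_in_sets_borel_prob[OF prob U(1)]] U(2) by simp
  qed
  then show "z \<in> measure_support X \<mu>"
    unfolding measure_support_def using act_in[OF g x(1)] x(2) by auto
qed

text \<open>Lets uniqueness on a subsystem identify a measure on \<open>X\<close> that is
  concentrated there: restriction yields an invariant measure on \<open>S\<close>, and nothing is
  lost when it is pushed back.\<close>

lemma restrict_invariant_prob:
  assumes \<mu>: "invariant_prob G X \<phi> \<mu>" and S: "closedin X S" "invariant_set G \<phi> S" "measure \<mu> S = 1"
  shows "invariant_prob G (subtopology X S) (restrict_action \<phi> S) (restrict_space \<mu> S)"
    and "distr (restrict_space \<mu> S) (borel_of X) (\<lambda>x. x) = \<mu>"
proof -
  have prob: "borel_prob X \<mu>" and inv: "\<And>g. g \<in> carrier G \<Longrightarrow> distr \<mu> (borel_of X) (\<phi> g) = \<mu>"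
    using \<mu> unfolding invariant_prob_def by auto
  interpret prob_space \<mu> by (rule borel_prob_prob_space[OF prob])
  have SX: "S \<subseteq> topspace X" using closedin_subset[OF S(1)] .
  have S': "S \<in> sets \<mu>" using closedin_in_sets_borel_prob[OF prob S(1)] .
  have sp: "space \<mu> = topspace X" using space_borel_prob[OF prob] .
  have sets: "sets (restrict_space \<mu> S) = sets (borel_of (subtopology X S))"
    unfolding sets_borel_of_subtopology[OF S(1)]
    using sets_borel_prob[OF prob] by (simp add: sets_restrict_space)
  have spr: "space (restrict_space \<mu> S) = S" using SX sp by (auto simp: space_restrict_space)
  have rsets: "A \<in> sets \<mu> \<and> A \<subseteq> S" if "A \<in> sets (restrict_space \<mu> S)" for A
    using that S' by (auto simp: sets_restrict_space)
  have em: "emeasure (restrict_space \<mu> S) A = emeasure \<mu> A" if "A \<in> sets (restrict_space \<mu> S)" for A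
    using rsets[OF that] S' by (intro emeasure_restrict_space) auto
  have "S \<in> sets (restrict_space \<mu> S)" using sets.top[of "restrict_space \<mu> S"] spr by simp
  then have "prob_space (restrict_space \<mu> S)"
    using em[of S] S(3) spr by (intro prob_spaceI) (simp add: emeasure_eq_measure)
  then have probS: "borel_prob (subtopology X S) (restrict_space \<mu> S)"
    unfolding borel_prob_def using sets by simp
  interpret S: compact_G_space G TG "subtopology X S" "restrict_action \<phi> S"
    by (rule compact_G_space.intro[OF topological_group compact_system_restrict[OF S(1,2)]])
  have "distr (restrict_space \<mu> S) (borel_of (subtopology X S)) (restrict_action \<phi> S g) = restrict_space \<mu> S"
    if g: "g \<in> carrier G" for g
  proof (rule measure_eqI)
    fix A assume "A \<in> sets (distr (restrict_space \<mu> S) (borel_of (subtopology X S)) (restrict_action \<phi> S g))"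
    then have A: "A \<in> sets (borel_of (subtopology X S))" by simp
    then have Ar: "A \<in> sets (restrict_space \<mu> S)" using sets by simp
    have A': "A \<in> sets \<mu>" "A \<subseteq> S" using rsets[OF Ar] by auto
    have meas: "restrict_action \<phi> S g \<in> measurable (restrict_space \<mu> S) (borel_of (subtopology X S))"
      by (rule S.act_measurable[OF probS g])
    \<comment> \<open>\<open>S\<close> is invariant under the inverse of \<open>g\<close> too, so
      points outside \<open>S\<close> do not enter \<open>A\<close>, and the preimages in
      \<open>S\<close> and in \<open>X\<close> agree.\<close>
    have "x \<in> S" if "x \<in> topspace X" "\<phi> g x \<in> A" for x
    proof -
      have "\<phi> (inv\<^bsub>G\<^esub> g) (\<phi> g x) \<in> S"
        using that A'(2) S(2) g unfolding invariant_set_def by blast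
      then show ?thesis using act_inv(1)[OF g that(1)] by simp
    qed
    then have pre: "restrict_action \<phi> S g -` A \<inter> space (restrict_space \<mu> S) = \<phi> g -` A \<inter> space \<mu>"
      using SX unfolding spr sp restrict_action_def by auto
    have "emeasure (distr (restrict_space \<mu> S) (borel_of (subtopology X S)) (restrict_action \<phi> S g)) A
        = emeasure (restrict_space \<mu> S) (restrict_action \<phi> S g -` A \<inter> space (restrict_space \<mu> S))"
      by (rule emeasure_distr[OF meas A])
    also have "\<dots> = emeasure \<mu> (\<phi> g -` A \<inter> space \<mu>)"
      using em[OF measurable_sets[OF meas A]] unfolding pre .
    also have "\<dots> = emeasure (distr \<mu> (borel_of X) (\<phi> g)) A"
      using A'(1) sets_borel_prob[OF prob] by (intro emeasure_distr[symmetric] act_measurable[OF prob g]) simp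
    also have "\<dots> = emeasure (restrict_space \<mu> S) A" using inv[OF g] em[OF Ar] by simp
    finally show "emeasure (distr (restrict_space \<mu> S) (borel_of (subtopology X S)) (restrict_action \<phi> S g)) A
        = emeasure (restrict_space \<mu> S) A" .
  qed (simp add: sets)
  then show "invariant_prob G (subtopology X S) (restrict_action \<phi> S) (restrict_space \<mu> S)"
    unfolding invariant_prob_def using probS by simp
  show "distr (restrict_space \<mu> S) (borel_of X) (\<lambda>x. x) = \<mu>"
  proof (rule measure_eqI)
    show "sets (distr (restrict_space \<mu> S) (borel_of X) (\<lambda>x. x)) = sets \<mu>"
      using sets_borel_prob[OF prob] by simp
    fix A assume "A \<in> sets (distr (restrict_space \<mu> S) (borel_of X) (\<lambda>x. x))"
    then have A: "A \<in> sets \<mu>" and A': "A \<in> sets (borel_of X)" using sets_borel_prob[OF prob] by auto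
    have "(\<lambda>x. x) \<in> measurable (restrict_space \<mu> S) (borel_of X)"
      using sets_borel_prob[OF prob] by (intro measurable_restrict_space1 measurable_ident_sets)
    then have "emeasure (distr (restrict_space \<mu> S) (borel_of X) (\<lambda>x. x)) A
        = emeasure (restrict_space \<mu> S) (A \<inter> S)"
      using A' by (simp add: emeasure_distr spr)
    also have "\<dots> = emeasure \<mu> (A \<inter> S)"
      using S' by (intro emeasure_restrict_space) auto
    also have "\<dots> = emeasure \<mu> A"
      using A S' AE_prob_1[OF S(3)] by (intro emeasure_eq_AE) auto
    finally show "emeasure (distr (restrict_space \<mu> S) (borel_of X) (\<lambda>x. x)) A = emeasure \<mu> A" .
  qed
qed

end

text \<open>Finitely many of the neighbourhoods from \<open>half_measure_separation\<close> cover
  \<open>N\<close>, and the least of their bounds works for all of them.\<close>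

lemma half_measure_separation_compact:
  assumes X: "dendron X" and \<mu>: "borel_prob X \<mu>"
    and supp: "\<And>U. openin X U \<Longrightarrow> U \<inter> S \<noteq> {} \<Longrightarrow> 0 < measure \<mu> U" and S: "S \<subseteq> topspace X"
    and x: "x \<in> S - N" and N: "compactin X N" "N \<subseteq> S"
  obtains \<delta> B where "0 < \<delta>" "\<delta> \<le> 1" "openin X B" "N \<subseteq> B"
    "\<And>w U. half X w U \<Longrightarrow> x \<in> U \<Longrightarrow> U \<inter> B \<noteq> {} \<Longrightarrow> \<delta> \<le> measure \<mu> U"
proof -
  have "\<exists>\<delta> B. 0 < \<delta> \<and> openin X B \<and> y \<in> B \<and>
    (\<forall>w U. half X w U \<longrightarrow> x \<in> U \<longrightarrow> U \<inter> B \<noteq> {} \<longrightarrow> \<delta> \<le> measure \<mu> U)" if y: "y \<in> N" for y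
  proof -
    have "x \<in> S" "y \<in> S" "x \<noteq> y" using x y N(2) by auto
    then obtain \<delta> B where "0 < \<delta>" "openin X B" "y \<in> B"
      "\<And>w U. half X w U \<Longrightarrow> x \<in> U \<Longrightarrow> U \<inter> B \<noteq> {} \<Longrightarrow> \<delta> \<le> measure \<mu> U"
      using half_measure_separation[OF X \<mu> supp _ _ _ S] by metis
    then show ?thesis by meson
  qed
  then obtain \<delta> B where \<delta>: "\<And>y. y \<in> N \<Longrightarrow> 0 < \<delta> y" and B: "\<And>y. y \<in> N \<Longrightarrow> openin X (B y)" "\<And>y. y \<in> N \<Longrightarrow> y \<in> B y"
    and bound: "\<And>y w U. y \<in> N \<Longrightarrow> half X w U \<Longrightarrow> x \<in> U \<Longrightarrow> U \<inter> B y \<noteq> {} \<Longrightarrow> \<delta> y \<le> measure \<mu> U"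
    by metis
  have "N \<subseteq> \<Union>(B ` N)" using B(2) by auto
  moreover have "\<forall>V\<in>B ` N. openin X V" using B(1) by auto
  ultimately obtain \<F> where "finite \<F>" "\<F> \<subseteq> B ` N" "N \<subseteq> \<Union>\<F>"
    using N(1) unfolding compactin_def by meson
  then obtain K where K: "finite K" "K \<subseteq> N" "N \<subseteq> \<Union>(B ` K)"
    using finite_subset_image by metis
  \<comment> \<open>Inserting 1 makes the minimum meaningful for empty \<open>K\<close> and yields
    the bound by 1, needed later when two halves cover the space.\<close>
  define e where "e = Min (insert 1 (\<delta> ` K))"
  show thesis
  proof
    show "0 < e" unfolding e_def using K(1,2) \<delta> by (subst Min_gr_iff) auto
    show "e \<le> 1" unfolding e_def using K(1) by (intro Min_le) auto
    show "openin X (\<Union>(B ` K))" using B(1) K(2) by (intro openin_Union) auto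
    show "N \<subseteq> \<Union>(B ` K)" by (rule K(3))
    fix w U assume U: "half X w U" "x \<in> U" "U \<inter> \<Union>(B ` K) \<noteq> {}"
    then obtain y where y: "y \<in> K" "U \<inter> B y \<noteq> {}" by auto
    have "e \<le> \<delta> y" unfolding e_def using K(1) y(1) by (intro Min_le) auto
    also have "\<dots> \<le> measure \<mu> U" using bound[OF _ U(1,2) y(2)] y(1) K(2) by auto
    finally show "e \<le> measure \<mu> U" .
  qed
qed

section \<open>Ergodic measures without atoms\<close>

context compact_G_space
begin

text \<open>The union is open, hence measurable for every \<open>G\<close>; it is invariant and
  contains \<open>U\<close>, so ergodicity raises its measure from positive to 1.\<close>

lemma ergodic_orbit_full:
  assumes \<mu>: "ergodic_prob G X \<phi> \<mu>" and U: "openin X U" "0 < measure \<mu> U"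
  shows "openin X (\<Union>g\<in>carrier G. \<phi> g ` U)" and "measure \<mu> (\<Union>g\<in>carrier G. \<phi> g ` U) = 1"
proof -
  let ?W = "\<Union>g\<in>carrier G. \<phi> g ` U"
  have prob: "borel_prob X \<mu>"
    using \<mu> unfolding ergodic_prob_def invariant_prob_def by auto
  interpret prob_space \<mu> by (rule borel_prob_prob_space[OF prob])
  have UX: "U \<subseteq> topspace X" using openin_subset[OF U(1)] .
  show W: "openin X ?W" using act_image_openin[OF _ U(1)] by (intro openin_Union) auto
  then have Ws: "?W \<in> sets \<mu>" by (rule openin_in_sets_borel_prob[OF prob])
  have "U \<subseteq> ?W"
  proof
    fix u assume u: "u \<in> U"
    then have "u = \<phi> \<one>\<^bsub>G\<^esub> u" using act_one UX by auto
    then show "u \<in> ?W" using u G.one_closed by blast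
  qed
  from finite_measure_mono[OF this Ws] have "0 < measure \<mu> ?W" using U(2) by simp
  then show "measure \<mu> ?W = 1"
    using ergodic_invariant_set[OF \<mu> Ws invariant_Union_image[OF UX]] by auto
qed

text \<open>Pairwise disjoint translates of \<open>U\<close> have equal positive measure, so a maximal disjoint family
  of them is finite. If no translate met both \<open>U\<close> and \<open>B\<close>, then intersecting the corresponding
  translates of \<open>B\<close> would give a neighbourhood of \<open>N\<close> missed by the whole orbit of \<open>U\<close>,
  which has full measure.\<close>

lemma ergodic_translate_meets:
  assumes \<mu>: "ergodic_prob G X \<phi> \<mu>" and U: "openin X U" "0 < measure \<mu> U"
    and B: "openin X B" "N \<subseteq> B" and N: "N \<subseteq> topspace X" "invariant_set G \<phi> N"
    and supp: "\<And>V. openin X V \<Longrightarrow> N \<subseteq> V \<Longrightarrow> 0 < measure \<mu> V"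
  shows "\<exists>h\<in>carrier G. \<phi> h ` U \<inter> U \<noteq> {} \<and> \<phi> h ` U \<inter> B \<noteq> {}"
proof (rule ccontr)
  assume neg: "\<not> ?thesis"
  have inv: "invariant_prob G X \<phi> \<mu>" and prob: "borel_prob X \<mu>"
    using \<mu> unfolding ergodic_prob_def invariant_prob_def by auto
  interpret prob_space \<mu> by (rule borel_prob_prob_space[OF prob])
  have UX: "U \<subseteq> topspace X" using openin_subset[OF U(1)] .
  have Us: "U \<in> sets \<mu>" using openin_in_sets_borel_prob[OF prob U(1)] .
  have "U \<noteq> {}" using U(2) by auto
  define P where "P K \<longleftrightarrow> finite K \<and> K \<subseteq> carrier G \<and> disjoint_family_on (\<lambda>g. \<phi> g ` U) K" for K
  obtain n :: nat where n: "1 / measure \<mu> U < n" using reals_Archimedean2 by blast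
  have "card K < n" if K: "P K" for K
  proof -
    have sets: "(\<lambda>g. \<phi> g ` U) ` K \<subseteq> sets \<mu>"
      using K act_image_sets[OF inv _ Us] unfolding P_def by auto
    have "measure \<mu> (\<Union>g\<in>K. \<phi> g ` U) = (\<Sum>g\<in>K. measure \<mu> (\<phi> g ` U))"
      using K sets unfolding P_def by (intro finite_measure_finite_Union) auto
    also have "\<dots> = card K * measure \<mu> U"
      using K act_image_measure[OF inv _ Us] unfolding P_def by (simp add: subset_iff)
    finally have "card K * measure \<mu> U \<le> 1" using prob_le_1 by metis
    then have "card K \<le> 1 / measure \<mu> U" using U(2) by (simp add: field_simps)
    then show ?thesis using n by linarith
  qed
  moreover have "P {}" unfolding P_def by (simp add: disjoint_family_on_def)
  ultimately obtain K where K: "P K" "\<And>L. P L \<Longrightarrow> card L \<le> card K"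
    using ex_has_greatest_nat[of P "{}" card n] by blast
  have meets: "\<exists>g\<in>K. \<phi> h ` U \<inter> \<phi> g ` U \<noteq> {}" if h: "h \<in> carrier G" for h
  proof (rule ccontr)
    assume disj: "\<not> ?thesis"
    then have "h \<notin> K" using \<open>U \<noteq> {}\<close> by auto
    moreover have "P (insert h K)"
      using K(1) h disj \<open>h \<notin> K\<close> unfolding P_def by (simp add: disjoint_family_on_insert) blast
    ultimately show False using K(1) K(2)[of "insert h K"] unfolding P_def by simp
  qed
  then have "K \<noteq> {}" using G.one_closed by blast
  have KG: "finite K" "K \<subseteq> carrier G" using K(1) unfolding P_def by auto
  \<comment> \<open>Each translate of \<open>B\<close> contains \<open>N\<close> because
    \<open>N\<close> is invariant, and finiteness of \<open>K\<close> keeps the intersection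
    open.\<close>
  define V where "V = (\<Inter>g\<in>K. \<phi> g ` B)"
  have "openin X V"
    unfolding V_def using KG \<open>K \<noteq> {}\<close> act_image_openin[OF _ B(1)] by (intro openin_Inter) auto
  moreover have "N \<subseteq> V"
    unfolding V_def
  proof (rule INT_greatest)
    fix g assume "g \<in> K"
    then have "\<phi> g ` N = N" using KG(2) N by (intro invariant_closed_image) auto
    then show "N \<subseteq> \<phi> g ` B" using B(2) by (metis image_mono)
  qed
  ultimately have "0 < measure \<mu> V" by (rule supp)
  have miss: "\<phi> h ` U \<inter> V = {}" if h: "h \<in> carrier G" for h
  proof -
    obtain g where g: "g \<in> K" "\<phi> h ` U \<inter> \<phi> g ` U \<noteq> {}" using meets[OF h] by blast
    then have gG: "g \<in> carrier G" using KG by auto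
    define k where "k = inv\<^bsub>G\<^esub> g \<otimes>\<^bsub>G\<^esub> h"
    have kG: "k \<in> carrier G" unfolding k_def using gG h by simp
    have "g \<otimes>\<^bsub>G\<^esub> k = h" unfolding k_def using gG h by (simp add: G.m_assoc[symmetric])
    then have hk: "\<phi> h u = \<phi> g (\<phi> k u)" if "u \<in> topspace X" for u
      using action.composition_rule[OF that gG kG] by simp
    have image: "\<phi> h ` U = \<phi> g ` (\<phi> k ` U)"
      unfolding image_image using UX hk by (intro image_cong) auto
    have inj: "inj_on (\<phi> g) (topspace X)" using action.inj_prop[OF gG] .
    have kU: "\<phi> k ` U \<subseteq> topspace X" using act_in[OF kG] UX by auto
    have "\<phi> g ` (\<phi> k ` U \<inter> U) = \<phi> h ` U \<inter> \<phi> g ` U"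
      unfolding image by (rule inj_on_image_Int[OF inj kU UX])
    then have "\<phi> k ` U \<inter> U \<noteq> {}" using g(2) by auto
    then have "\<phi> k ` U \<inter> B = {}" using neg kG by blast
    moreover have "\<phi> g ` (\<phi> k ` U \<inter> B) = \<phi> h ` U \<inter> \<phi> g ` B"
      unfolding image by (rule inj_on_image_Int[OF inj kU openin_subset[OF B(1)]])
    ultimately have "\<phi> h ` U \<inter> \<phi> g ` B = {}" by simp
    then show ?thesis unfolding V_def using g(1) by blast
  qed
  define W where "W = (\<Union>g\<in>carrier G. \<phi> g ` U)"
  have Ws: "W \<in> sets \<mu>" and W1: "measure \<mu> W = 1"
    unfolding W_def using ergodic_orbit_full[OF \<mu> U] openin_in_sets_borel_prob[OF prob] by auto
  have Vs: "V \<in> sets \<mu>" by (rule openin_in_sets_borel_prob[OF prob \<open>openin X V\<close>])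
  have "V \<inter> W = {}" unfolding W_def using miss by blast
  then have "measure \<mu> V + measure \<mu> W \<le> 1"
    using finite_measure_Union[OF Vs Ws] prob_le_1[of "V \<union> W"] by simp
  then show False using \<open>0 < measure \<mu> V\<close> W1 by simp
qed

text \<open>One small half meeting the support is enough: it has positive measure, so its translates
  cover almost everything, and they are halves of the same measure.\<close>

lemma ergodic_small_halves:
  assumes X: "dendrite X" and \<mu>: "ergodic_prob G X \<phi> \<mu>"
    and atomless: "\<And>x. x \<in> topspace X \<Longrightarrow> measure \<mu> {x} = 0" and "0 < e"
  shows "AE x in \<mu>. \<exists>w U. half X w U \<and> x \<in> U \<and> measure \<mu> U < e"
proof -
  have inv: "invariant_prob G X \<phi> \<mu>" and prob: "borel_prob X \<mu>"
    using \<mu> unfolding ergodic_prob_def invariant_prob_def by auto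
  have metr: "metrizable_space X" using X unfolding dendrite_def by simp
  interpret prob_space \<mu> by (rule borel_prob_prob_space[OF prob])
  have atomless': "measure \<mu> {x} = 0" if "x \<in> measure_support X \<mu>" for x
    using that atomless unfolding measure_support_def by blast
  have supp: "0 < measure \<mu> V" if "openin X V" "V \<inter> measure_support X \<mu> \<noteq> {}" for V
    using that by (rule measure_support_open_pos)
  obtain w U where U: "half X w U" "U \<inter> measure_support X \<mu> \<noteq> {}" "measure \<mu> U < e"
    using dendrite_small_half[OF X prob closedin_measure_support measure_measure_support[OF compact metr prob]
      supp atomless' \<open>0 < e\<close>] by blast
  have "openin X U" using U(1) unfolding half_def by simp
  then have "0 < measure \<mu> U" using measure_support_open_pos U(2) by auto
  define W where "W = (\<Union>g\<in>carrier G. \<phi> g ` U)"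
  have "measure \<mu> W = 1"
    unfolding W_def by (rule ergodic_orbit_full[OF \<mu> \<open>openin X U\<close> \<open>0 < measure \<mu> U\<close>])
  then have "AE x in \<mu>. x \<in> W" by (rule AE_prob_1)
  then show ?thesis
  proof (rule AE_mp, intro AE_I2 impI)
    fix x assume "x \<in> W"
    then obtain g where g: "g \<in> carrier G" "x \<in> \<phi> g ` U" unfolding W_def by blast
    have "measure \<mu> (\<phi> g ` U) < e"
      using act_image_measure[OF inv g(1) half_in_sets[OF prob U(1)]] U(3) by simp
    then show "\<exists>w U. half X w U \<and> x \<in> U \<and> measure \<mu> U < e"
      using act_half[OF g(1) U(1)] g(2) by blast
  qed
qed

text \<open>A proper closed invariant subset \<open>N\<close> of the support is impossible: small halves around a point
  outside \<open>N\<close> stay away from \<open>N\<close>, while ergodicity carries one of them close to \<open>N\<close>.\<close>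

theorem ergodic_support_minimal:
  assumes X: "dendrite X" and \<mu>: "ergodic_prob G X \<phi> \<mu>"
    and atomless: "\<And>x. x \<in> topspace X \<Longrightarrow> measure \<mu> {x} = 0"
  shows "minimal_subset G X \<phi> (measure_support X \<mu>)"
proof -
  let ?S = "measure_support X \<mu>"
  have inv: "invariant_prob G X \<phi> \<mu>" and prob: "borel_prob X \<mu>"
    using \<mu> unfolding ergodic_prob_def invariant_prob_def by auto
  have metr: "metrizable_space X" and D: "dendron X" and conn: "connected_space X"
    using X unfolding dendrite_def dendron_def by auto
  interpret prob_space \<mu> by (rule borel_prob_prob_space[OF prob])
  have S1: "measure \<mu> ?S = 1" by (rule measure_measure_support[OF compact metr prob])
  have Scl: "closedin X ?S" by (rule closedin_measure_support)
  have SX: "?S \<subseteq> topspace X" using closedin_subset[OF Scl] .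
  have supp: "0 < measure \<mu> V" if "openin X V" "V \<inter> measure_support X \<mu> \<noteq> {}" for V
    using that by (rule measure_support_open_pos)
  have False if N: "N \<noteq> {}" "closedin X N" "invariant_set G \<phi> N" "N \<subseteq> ?S" "N \<noteq> ?S" for N
  proof -
    \<comment> \<open>The bound \<delta> will depend on \<open>x\<close>, so \<open>x\<close> must
      be chosen with small halves of every order before \<delta> is known.\<close>
    have small_AE: "AE x in \<mu>. \<forall>n::nat. \<exists>w U. half X w U \<and> x \<in> U \<and> measure \<mu> U < 1 / Suc n"
      unfolding AE_all_countable using ergodic_small_halves[OF X \<mu> atomless] by simp
    have S_AE: "AE x in \<mu>. x \<in> ?S" using S1 by (rule AE_prob_1)
    have not_AE: "\<not> (AE x in \<mu>. x \<notin> topspace X - N)"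
    proof -
      have "openin X (topspace X - N)" using N(2) by blast
      moreover from this have "0 < measure \<mu> (topspace X - N)"
        using N(4,5) SX by (intro measure_support_open_pos) auto
      ultimately show ?thesis
        using prob_eq_0[OF openin_in_sets_borel_prob[OF prob], of "topspace X - N"] by (metis less_irrefl)
    qed
    have "\<exists>x. (\<forall>n::nat. \<exists>w U. half X w U \<and> x \<in> U \<and> measure \<mu> U < 1 / Suc n) \<and> x \<in> ?S - N"
    proof (rule ccontr)
      assume none: "\<not> ?thesis"
      from small_AE S_AE have "AE x in \<mu>. x \<notin> topspace X - N"
        by eventually_elim (use none in blast)
      then show False using not_AE by simp
    qed
    then obtain x where small: "\<And>n::nat. \<exists>w U. half X w U \<and> x \<in> U \<and> measure \<mu> U < 1 / Suc n"
      and x: "x \<in> ?S - N" by blast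
    obtain \<delta> B where \<delta>: "0 < \<delta>" "\<delta> \<le> 1" and B: "openin X B" "N \<subseteq> B"
      and far: "\<And>w U. half X w U \<Longrightarrow> x \<in> U \<Longrightarrow> U \<inter> B \<noteq> {} \<Longrightarrow> \<delta> \<le> measure \<mu> U"
      using half_measure_separation_compact[OF D prob supp SX x
        closedin_compact_space[OF compact N(2)] N(4)] by metis
    \<comment> \<open>The measures of the half and its translate get added, so each must stay below
      half of the bound.\<close>
    obtain n :: nat where n: "1 / Suc n < \<delta> / 2" using nat_approx_posE[of "\<delta> / 2"] \<delta>(1) by auto
    obtain w U where U: "half X w U" "x \<in> U" and "measure \<mu> U < 1 / Suc n" using small by blast
    with n have U\<delta>: "measure \<mu> U < \<delta> / 2" by linarith
    have Uo: "openin X U" using U(1) unfolding half_def by simp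
    have "0 < measure \<mu> U" using U(2) x by (intro measure_support_open_pos[OF Uo]) auto
    moreover have "0 < measure \<mu> V" if "openin X V" "N \<subseteq> V" for V
      using that N(1,4) by (intro measure_support_open_pos) auto
    moreover have "N \<subseteq> topspace X" using closedin_subset[OF N(2)] .
    ultimately obtain h where h: "h \<in> carrier G" "\<phi> h ` U \<inter> U \<noteq> {}" "\<phi> h ` U \<inter> B \<noteq> {}"
      using ergodic_translate_meets[OF \<mu> Uo _ B _ N(3)] by metis
    let ?V = "\<phi> h ` U"
    have V: "half X (\<phi> h w) ?V" by (rule act_half[OF h(1) U(1)])
    have Us: "U \<in> sets \<mu>" "?V \<in> sets \<mu>" using half_in_sets[OF prob] U(1) V by auto
    have V\<delta>: "measure \<mu> ?V < \<delta> / 2" using act_image_measure[OF inv h(1) Us(1)] U\<delta> by simp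
    have sum: "measure \<mu> (U \<union> ?V) < \<delta>" using measure_Un_le[OF Us] U\<delta> V\<delta> by simp
    \<comment> \<open>The translate meets \<open>U\<close>, so disjointness is out. If the halves do
      not cover the space, their union is a half containing \<open>x\<close>, meeting
      \<open>B\<close> and smaller than \<delta>; if they do, the total measure 1 would lie below
      \<delta>.\<close>
    have "w = \<phi> h w \<or> U \<subseteq> ?V \<or> ?V \<subseteq> U \<or> U \<union> ?V = topspace X"
      using half_subset_half[OF conn U(1) V] half_subset_half[OF conn V U(1)]
        half_disjoint_half[OF conn U(1) V] half_cover_half[OF conn U(1) V] h(2) by blast
    then show False
    proof (elim disjE)
      assume "w = \<phi> h w"
      then have "half X w (U \<union> ?V)" using half_Un[OF U(1)] V by simp
      then have "\<delta> \<le> measure \<mu> (U \<union> ?V)" using U(2) h(3) by (intro far) auto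
      then show False using sum by simp
    next
      assume "U \<subseteq> ?V"
      then have "\<delta> \<le> measure \<mu> ?V" using U(2) h(3) by (intro far[OF V]) auto
      then show False using V\<delta> \<delta>(1) by simp
    next
      assume "?V \<subseteq> U"
      then have "\<delta> \<le> measure \<mu> U" using U(2) h(3) by (intro far[OF U(1)]) auto
      then show False using U\<delta> \<delta>(1) by simp
    next
      assume "U \<union> ?V = topspace X"
      then have "measure \<mu> (U \<union> ?V) = 1" using prob_space space_borel_prob[OF prob] by simp
      then show False using sum \<delta>(2) by simp
    qed
  qed
  moreover have "?S \<noteq> {}" using S1 by auto
  ultimately show ?thesis
    unfolding minimal_subset_def using Scl invariant_measure_support[OF inv] by blast
qed

end

theorem corollary6p3:
  fixes G :: "('g, 'm) monoid_scheme"
    and TG :: "'g topology"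
    and X :: "'x topology"
    and \<phi> :: "'g \<Rightarrow> 'x \<Rightarrow> 'x"
  assumes "topological_group G TG"
    and "amenable_group G TG"
    and "dendrite X"
    and "compact_system G TG X \<phi>"
  shows "(\<forall>M. minimal_subset G X \<phi> M \<longrightarrow>
            (\<exists>(Z :: 'x set topology) \<psi> \<iota>.
               minimal_system G TG Z \<psi> \<and> equicontinuous_system G TG Z \<psi> \<and>
               almost_one_to_one_extension G TG
                 (subtopology X M) (restrict_action \<phi> M) Z \<psi> \<iota> \<and>
               (\<exists>\<mu> \<nu>.
                  unique_invariant_prob G (subtopology X M) (restrict_action \<phi> M) \<mu> \<and>
                  haar_measure G Z \<psi> \<nu> \<and>
                  measure_isomorphism G (restrict_action \<phi> M) \<mu> \<psi> \<nu> \<iota>))) \<and>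
         (\<forall>\<mu>. ergodic_prob G X \<phi> \<mu> \<longrightarrow>
            (\<exists>F. finite F \<and> F \<noteq> {} \<and> F \<subseteq> topspace X \<and> \<mu> = uniform_distribution X F) \<or>
            (\<exists>M \<nu>. minimal_subset G X \<phi> M \<and> infinite M \<and>
               almost_automorphic G TG (subtopology X M) (restrict_action \<phi> M) \<and>
               unique_invariant_prob G (subtopology X M) (restrict_action \<phi> M) \<nu> \<and>
               \<mu> = distr \<nu> (borel_of X) (\<lambda>x. x)))"
proof -
  interpret compact_G_space G TG X \<phi>
    by (rule compact_G_space.intro[OF assms(1,4)])
  note parts = minimal_subset_structure[OF assms(2,3)]
  have "(\<exists>F. finite F \<and> F \<noteq> {} \<and> F \<subseteq> topspace X \<and> \<mu> = uniform_distribution X F) \<or>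
      (\<exists>M \<nu>. minimal_subset G X \<phi> M \<and> infinite M \<and>
         almost_automorphic G TG (subtopology X M) (restrict_action \<phi> M) \<and>
         unique_invariant_prob G (subtopology X M) (restrict_action \<phi> M) \<nu> \<and>
         \<mu> = distr \<nu> (borel_of X) (\<lambda>x. x))"
    if \<mu>: "ergodic_prob G X \<phi> \<mu>" for \<mu>
  \<comment> \<open>An atom leads to a finite orbit of full measure; without atoms the support is
    the minimal set sought.\<close>
  proof (cases "\<exists>x\<in>topspace X. 0 < measure \<mu> {x}")
    case True
    then obtain x where x: "x \<in> topspace X" "0 < measure \<mu> {x}" by blast
    show ?thesis
      using ergodic_atom_uniform[OF \<mu> x] orbit_subset[OF x(1)] action.orbit_refl[OF x(1)]
      by (intro disjI1 exI[of _ "orbit G \<phi> x"]) auto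
  next
    case False
    then have atomless: "measure \<mu> {x} = 0" if "x \<in> topspace X" for x
      using that by (auto simp: zero_less_measure_iff)
    let ?M = "measure_support X \<mu>"
    have inv: "invariant_prob G X \<phi> \<mu>" and prob: "borel_prob X \<mu>"
      using \<mu> unfolding ergodic_prob_def invariant_prob_def by auto
    interpret prob_space \<mu> by (rule borel_prob_prob_space[OF prob])
    have metr: "metrizable_space X" using assms(3) unfolding dendrite_def by simp
    have M: "minimal_subset G X \<phi> ?M" by (rule ergodic_support_minimal[OF assms(3) \<mu> atomless])
    have M1: "measure \<mu> ?M = 1" by (rule measure_measure_support[OF compact metr prob])
    have closed: "closedin X ?M" by (rule closedin_measure_support)
    then have MX: "?M \<subseteq> topspace X" by (rule closedin_subset)
    have "infinite ?M"
    proof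
      assume fin: "finite ?M"
      have "{x} \<in> sets \<mu>" if "x \<in> ?M" for x
        using that MX Hausdorff by (intro closedin_in_sets_borel_prob[OF prob]) (auto simp: closedin_Hausdorff_sing_eq)
      then have "measure \<mu> ?M = (\<Sum>x\<in>?M. measure \<mu> {x})"
        by (intro finite_measure_eq_sum_singleton fin)
      also have "\<dots> = 0" using atomless MX by (intro sum.neutral) auto
      finally show False using M1 by simp
    qed
    moreover have "almost_automorphic G TG (subtopology X ?M) (restrict_action \<phi> ?M)"
      unfolding almost_automorphic_def using parts[OF M] by blast
    moreover obtain \<nu> where \<nu>: "unique_invariant_prob G (subtopology X ?M) (restrict_action \<phi> ?M) \<nu>"
      using parts[OF M] by blast
    moreover have "\<mu> = distr \<nu> (borel_of X) (\<lambda>x. x)"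
    proof -
      note r = restrict_invariant_prob[OF inv closed invariant_measure_support[OF inv] M1]
      \<comment> \<open>Unique ergodicity of the support identifies the restriction of
        \<mu>.\<close>
      have "restrict_space \<mu> ?M = \<nu>" using \<nu> r(1) unfolding unique_invariant_prob_def by blast
      then show ?thesis using r(2) by simp
    qed
    ultimately show ?thesis using M by blast
  qed
  then show ?thesis using parts by blast
qed

end
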